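(* Let $a\in(0,\pi/3)$, let $h\in L_2(5a/2,3a)$ be a nonzero real-valued function, let $\eta$ be a nonzero eigenvalue of the operator $M_h$, put $h_0:=h/\eta$, and let $e_0$ be an eigenfunction of $M_{h_0}$ related to the eigenvalue $1$, i.e. $M_{h_0}e_0(x)=e_0(x)$ for $3a/2<x<2a$. For $\alpha\in\mathbb{C}$ define $$q_{\alpha,0}(x)=\begin{cases}0,& x\in(0,\tfrac{3a}2),\\ \alpha e_0(x),& x\in(\tfrac{3a}2,2a),\\ -\alpha K_{h_0}\big(x+\tfrac a2\big)\displaystyle\int_{3a/2}^{x-a/2}e_0(t)\,dt,& x\in(2a,\tfrac{5a}2),\\ h_0(x),& x\in(\tfrac{5a}2,3a),\\ 0,& x\in(3a,\pi).\end{cases}$$ Then, for each $j\in\{0,1\}$, the spectrum of the boundary value problem ${\cal L}_{0,j}(a,q_{\alpha,0})$ is independent of $\alpha\in\mathbb{C}$.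
   Context: For $a\in(0,\pi/3)$ and $h\in L_2(5a/2,3a)$, the integral operator $M_h$ in $L_2(3a/2,2a)$ is $$M_hf(x)=\int_{3a/2}^{7a/2-x}K_h\Big(x+t-\frac a2\Big)f(t)\,dt,\quad \frac{3a}2<x<2a,\qquad K_h(x)=\int_x^{3a}h(\tau)\,d\tau.$$ For real-valued nonzero $h$ it is a nonzero compact Hermitian operator, so it has at least one nonzero eigenvalue. For $j\in\{0,1\}$ and a complex-valued $q\in L_2(0,\pi)$ with $q(x)=0$ on $(0,a)$, ${\cal L}_{0,j}(a,q)$ denotes the boundary value problem $$-y''(x)+q(x)y(x-a)=\lambda y(x),\quad 0<x<\pi,\qquad y(0)=y^{(j)}(\pi)=0.$$ (The values of $y$ at negative arguments are irrelevant because $q=0$ on $(0,a)$.) Its spectrum is the sequence of its eigenvalues counted with multiplicities, i.e. the zeros with multiplicities of the entire function $\Delta_{0,j}(\lambda)=y_1^{(j)}(\pi,\lambda)$ (derivative with respect to the first argument), where $y_1(x,\lambda)$ is the unique solution of the differential equation $-y''(x)+q(x)y(x-a)=\lambda y(x)$, $0<x<\pi$, with $y_1(0,\lambda)=0$, $y_1'(0,\lambda)=1$. *)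

theory Defs
  imports "HOL-Analysis.Analysis" "HOL-Complex_Analysis.Complex_Analysis"
begin

text \<open>Functions in $L_2$ are represented by concrete representatives; equality in $L_2$ is
  equality almost everywhere.\<close>

definition L2_on :: "real set \<Rightarrow> (real \<Rightarrow> 'b::real_normed_vector) \<Rightarrow> bool" where
  "L2_on S f \<longleftrightarrow> f \<in> borel_measurable (lebesgue_on S) \<and>
     integrable (lebesgue_on S) (\<lambda>x. (norm (f x))\<^sup>2)"

definition nonzero_on :: "real set \<Rightarrow> (real \<Rightarrow> 'b::zero) \<Rightarrow> bool" where
  "nonzero_on S f \<longleftrightarrow> \<not> (AE x in lebesgue_on S. f x = 0)"

definition K_ker :: "real \<Rightarrow> (real \<Rightarrow> complex) \<Rightarrow> real \<Rightarrow> complex" where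
  "K_ker a h x = (LINT t|lebesgue_on {x<..<3*a}. h t)"

definition M_op :: "real \<Rightarrow> (real \<Rightarrow> complex) \<Rightarrow> (real \<Rightarrow> complex) \<Rightarrow> real \<Rightarrow> complex" where
  "M_op a h f x = (LINT t|lebesgue_on {3*a/2<..<7*a/2 - x}. K_ker a h (x + t - a/2) * f t)"

definition M_eigenfunction ::
  "real \<Rightarrow> (real \<Rightarrow> complex) \<Rightarrow> complex \<Rightarrow> (real \<Rightarrow> complex) \<Rightarrow> bool" where
  "M_eigenfunction a h \<eta> e \<longleftrightarrow>
     L2_on {3*a/2<..<2*a} e \<and> nonzero_on {3*a/2<..<2*a} e \<and>
     (AE x in lebesgue_on {3*a/2<..<2*a}. M_op a h e x = \<eta> * e x)"

definition M_eigenvalue :: "real \<Rightarrow> (real \<Rightarrow> complex) \<Rightarrow> complex \<Rightarrow> bool" where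
  "M_eigenvalue a h \<eta> \<longleftrightarrow> (\<exists>e. M_eigenfunction a h \<eta> e)"

text \<open>The value $0$ at the breakpoints is an arbitrary choice on a null set.\<close>

definition q_fam ::
  "real \<Rightarrow> (real \<Rightarrow> complex) \<Rightarrow> (real \<Rightarrow> complex) \<Rightarrow> complex \<Rightarrow> real \<Rightarrow> complex" where
  "q_fam a h0 e0 \<alpha> x =
     (if 3*a/2 < x \<and> x < 2*a then \<alpha> * e0 x
      else if 2*a < x \<and> x < 5*a/2 then
        - \<alpha> * K_ker a h0 (x + a/2) * (LINT t|lebesgue_on {3*a/2<..<x - a/2}. e0 t)
      else if 5*a/2 < x \<and> x < 3*a then h0 x
      else 0)"

text \<open>Derivative on the closed interval $[0,\pi]$, one-sided at the endpoints.\<close>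

definition D_pi :: "(real \<Rightarrow> complex) \<Rightarrow> real \<Rightarrow> complex" where
  "D_pi y x = vector_derivative y (at x within {0..pi})"

text \<open>As the potential is only square-integrable, a solution is a function that is differentiable
  on $[0,\pi]$ with absolutely continuous derivative and that satisfies the equation almost
  everywhere. Absolute continuity of $y'$ is expressed by saying that $y'$ is the indefinite
  Lebesgue integral of an integrable function $w$, which is then the second derivative $y''$.
  The values of $y$ at negative arguments do not matter if $q$ vanishes on $(0,a)$.\<close>

definition is_solution ::
  "real \<Rightarrow> (real \<Rightarrow> complex) \<Rightarrow> complex \<Rightarrow> (real \<Rightarrow> complex) \<Rightarrow> bool" where
  "is_solution a q l y \<longleftrightarrow>
     y differentiable_on {0..pi} \<and>
     (\<exists>w. integrable (lebesgue_on {0..pi}) w \<and>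
          (\<forall>x\<in>{0..pi}. D_pi y x = D_pi y 0 + (LINT t|lebesgue_on {0..x}. w t)) \<and>
          (AE x in lebesgue_on {0<..<pi}. - w x + q x * y (x - a) = l * y x))"

text \<open>Restricting to functions that are extensional on $[0,\pi]$ makes the solution of the
  initial value problem unique as a total function.\<close>

definition y_one :: "real \<Rightarrow> (real \<Rightarrow> complex) \<Rightarrow> complex \<Rightarrow> real \<Rightarrow> complex" where
  "y_one a q l =
     (THE y. y \<in> extensional {0..pi} \<and> is_solution a q l y \<and> y 0 = 0 \<and> D_pi y 0 = 1)"

definition char_fun :: "nat \<Rightarrow> real \<Rightarrow> (real \<Rightarrow> complex) \<Rightarrow> complex \<Rightarrow> complex" where
  "char_fun j a q l = (D_pi ^^ j) (y_one a q l) pi"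

text \<open>The spectrum, as the set of eigenvalues each paired with its multiplicity.\<close>

definition bvp_spectrum :: "nat \<Rightarrow> real \<Rightarrow> (real \<Rightarrow> complex) \<Rightarrow> (complex \<times> int) set" where
  "bvp_spectrum j a q = {(l, zorder (char_fun j a q) l) | l. char_fun j a q l = 0}"

end

theory Submission
  imports Defs
begin

text \<open>
  Put \<open>s = sn l\<close>, the solution of \<open>s'' = - l s\<close>, \<open>s(0) = 0\<close>, \<open>s'(0) = 1\<close>. As \<open>q\<close> lives on \<open>(3a/2, 3a)\<close>
  and the delay is \<open>a\<close>, variation of constants expresses \<open>y\<^sub>1(x)\<close> by one linear and one quadratic integral
  in \<open>q\<close>. For \<open>x \<ge> 3a\<close> the quadratic one only pairs the values of \<open>q\<close> on \<open>(5a/2, 3a)\<close> with those on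
  \<open>(3a/2, 2a)\<close>, so \<open>y\<^sub>1(x)\<close> is affine in \<open>\<alpha>\<close>. With \<open>C = ps l\<close>, writing \<open>s(A) s(B)\<close> as \<open>C(A - B) - C(A + B)\<close>
  and integrating by parts (Fubini), the coefficient of \<open>\<alpha>\<close> turns into
  \<open>\<integral> (C(x - a) - C(x - 2v + a)) (M\<^sub>h\<^sub>0 e\<^sub>0 - e\<^sub>0)(v) dv = 0\<close>. Hence \<open>y\<^sub>1\<close> does not depend on \<open>\<alpha>\<close> on
  \<open>[3a, \<pi>]\<close>, and neither does the characteristic function.
\<close>

subsection \<open>Integrable functions of compact support\<close>

text \<open>A countable cover by Borel sets of finite \<open>lborel\<close> measure also serves the
  completion. This makes Fubini available over \<open>lebesgue\<close>, with respect to which the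
  given L2 functions are measurable.\<close>

lemma sigma_finite_lebesgue: "sigma_finite_measure (lebesgue :: real measure)"
proof -
  obtain A :: "real set set" where A: "countable A" "A \<subseteq> sets lborel" "\<Union>A = space lborel"
    "\<forall>a\<in>A. emeasure lborel a \<noteq> \<infinity>"
    using lborel.sigma_finite_countable by blast
  show ?thesis
    by standard (use A in \<open>auto intro!: exI[of _ A]\<close>)
qed

interpretation lebesgue: sigma_finite_measure "lebesgue :: real measure"
  by (rule sigma_finite_lebesgue)

interpretation lebesgue_pair: pair_sigma_finite "lebesgue :: real measure" "lebesgue :: real measure" ..

text \<open>Continuous kernels and open regions in the plane are Borel; this identity map carries
  their measurability over to the product of two \<open>lebesgue\<close> spaces.\<close>

lemma measurable_pair_lebesgue_borel:
  "(\<lambda>p. p) \<in> (lebesgue \<Otimes>\<^sub>M lebesgue :: (real \<times> real) measure) \<rightarrow>\<^sub>M borel"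
proof -
  have [measurable]: "(\<lambda>x::real. x) \<in> lebesgue \<rightarrow>\<^sub>M borel"
    by (auto intro!: measurable_completion)
  have "(\<lambda>p. (fst p, snd p)) \<in> (lebesgue \<Otimes>\<^sub>M lebesgue :: (real \<times> real) measure) \<rightarrow>\<^sub>M borel \<Otimes>\<^sub>M borel"
    by measurable
  then show ?thesis by (simp add: borel_prod)
qed

text \<open>Compact support makes the class stable under multiplication by any continuous function,
  so trigonometric kernels on the whole line require no global bounds.\<close>

definition cpt_integrable :: "(real \<Rightarrow> complex) \<Rightarrow> bool" where
  "cpt_integrable f \<longleftrightarrow> integrable lebesgue f \<and> (\<exists>A. \<forall>x. f x \<noteq> 0 \<longrightarrow> x \<in> {-A..A})"

lemma cpt_integrableI:
  "integrable lebesgue f \<Longrightarrow> (\<And>x. f x \<noteq> 0 \<Longrightarrow> x \<in> {-A..A}) \<Longrightarrow> cpt_integrable f"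
  unfolding cpt_integrable_def by blast

lemma cpt_integrableE:
  assumes "cpt_integrable f"
  obtains A where "integrable lebesgue f" "\<And>x. f x \<noteq> 0 \<Longrightarrow> x \<in> {-A..A}"
  using assms unfolding cpt_integrable_def by blast

lemma cpt_integrableD [dest]: "cpt_integrable f \<Longrightarrow> integrable lebesgue f"
  by (simp add: cpt_integrable_def)

lemma cpt_integrable_add:
  assumes "cpt_integrable f" "cpt_integrable g"
  shows "cpt_integrable (\<lambda>x. f x + g x)"
proof -
  obtain A where A: "integrable lebesgue f" "\<And>x. f x \<noteq> 0 \<Longrightarrow> x \<in> {-A..A}"
    using cpt_integrableE[OF assms(1)] by blast
  obtain B where B: "integrable lebesgue g" "\<And>x. g x \<noteq> 0 \<Longrightarrow> x \<in> {-B..B}"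
    using cpt_integrableE[OF assms(2)] by blast
  show ?thesis
  proof (rule cpt_integrableI[where A = "max A B"])
    fix x assume "f x + g x \<noteq> 0"
    then have "f x \<noteq> 0 \<or> g x \<noteq> 0" by auto
    then show "x \<in> {- max A B..max A B}"
      using A(2)[of x] B(2)[of x] by (auto simp: max_def)
  qed (intro Bochner_Integration.integrable_add A(1) B(1))
qed

lemma continuous_bounded_Icc:
  fixes \<phi> :: "real \<Rightarrow> complex"
  assumes "continuous_on UNIV \<phi>"
  obtains B where "\<And>x. x \<in> {-A..A} \<Longrightarrow> norm (\<phi> x) \<le> B"
proof -
  have "compact (\<phi> ` {-A..A})"
    by (intro compact_continuous_image continuous_on_subset[OF assms]) auto
  then obtain B where "\<forall>z\<in>\<phi> ` {-A..A}. norm z \<le> B"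
    using compact_imp_bounded bounded_iff by metis
  then show ?thesis using that[of B] by blast
qed

lemma borel_measurable_lebesgueI:
  "f \<in> borel_measurable borel \<Longrightarrow> f \<in> borel_measurable lebesgue"
  by (auto intro!: measurable_completion)

lemma cpt_integrable_mult:
  assumes "cpt_integrable f" "continuous_on UNIV \<phi>"
  shows "cpt_integrable (\<lambda>x. f x * \<phi> x)"
proof -
  obtain A where f: "integrable lebesgue f" and A: "\<And>x. f x \<noteq> 0 \<Longrightarrow> x \<in> {-A..A}"
    using cpt_integrableE[OF assms(1)] by blast
  obtain B where B: "\<And>x. x \<in> {-A..A} \<Longrightarrow> norm (\<phi> x) \<le> B"
    using continuous_bounded_Icc[OF assms(2)] by blast
  have [measurable]: "\<phi> \<in> borel_measurable lebesgue" "f \<in> borel_measurable lebesgue"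
    using assms(2) f by (auto intro!: borel_measurable_lebesgueI borel_measurable_continuous_onI)
  have "norm (f x * \<phi> x) \<le> norm (of_real B * f x)" for x
  proof (cases "f x = 0")
    case False
    then have "norm (\<phi> x) \<le> \<bar>B\<bar>" using B[OF A] by (meson abs_ge_self order_trans)
    then have "norm (f x) * norm (\<phi> x) \<le> norm (f x) * \<bar>B\<bar>" by (intro mult_left_mono) auto
    then show ?thesis by (simp add: norm_mult mult.commute)
  qed auto
  note le = this
  have "integrable lebesgue (\<lambda>x. f x * \<phi> x)"
    by (rule Bochner_Integration.integrable_bound[of lebesgue "\<lambda>x. of_real B * f x"])
       (use f le in auto)
  then show ?thesis by (rule cpt_integrableI) (rule A, simp)
qed

lemma cpt_integrable_cmult: "cpt_integrable f \<Longrightarrow> cpt_integrable (\<lambda>x. c * f x)"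
  using cpt_integrable_mult[of f "\<lambda>_. c"] by (simp add: mult.commute)

lemma cpt_integrable_if:
  assumes "cpt_integrable f" "{x. P x} \<in> sets lebesgue"
  shows "cpt_integrable (\<lambda>x. if P x then f x else 0)"
proof -
  have "integrable lebesgue (\<lambda>x. indicator {x. P x} x *\<^sub>R f x)"
    using assms by (intro integrable_mult_indicator) auto
  moreover have "(\<lambda>x. indicator {x. P x} x *\<^sub>R f x) = (\<lambda>x. if P x then f x else 0)"
    by (auto simp: indicator_def)
  ultimately have "integrable lebesgue (\<lambda>x. if P x then f x else 0)" by simp
  note int = this
  obtain A where A: "\<And>x. f x \<noteq> 0 \<Longrightarrow> x \<in> {-A..A}"
    using cpt_integrableE[OF assms(1)] by blast
  show ?thesis by (rule cpt_integrableI[OF int]) (rule A, auto split: if_splits)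
qed

text \<open>Lets a merely continuous function enter \<open>cpt_Fubini\<close>: the indicator plays
  the role of the integrable factor, the function that of the kernel.\<close>

lemma cpt_integrable_Icc: "cpt_integrable (\<lambda>x. if A \<le> x \<and> x \<le> B then 1 else 0)"
proof -
  have "integrable lebesgue (indicator {A..B} :: real \<Rightarrow> real)"
    by (simp add: integrable_indicator_iff emeasure_lborel_Icc_eq)
  then have "integrable lebesgue (\<lambda>x. complex_of_real (indicator {A..B} x))"
    by (rule integrable_of_real)
  moreover have "(\<lambda>x. complex_of_real (indicator {A..B} x)) = (\<lambda>x. if A \<le> x \<and> x \<le> B then 1 else 0)"
    by (auto simp: indicator_def fun_eq_iff)
  ultimately show ?thesis
    by (intro cpt_integrableI[where A = "max \<bar>A\<bar> \<bar>B\<bar>"]) (auto split: if_splits)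
qed

text \<open>By compactness \<open>\<phi>\<close> is bounded by some \<open>C\<close> on the product
  of the two supports, so the integrand is dominated by \<open>C\<close> times the product of
  \<open>f\<close> and \<open>g\<close>, which is integrable in the plane. The predicate
  \<open>P\<close> carries the region of integration.\<close>

lemma cpt_Fubini:
  fixes \<phi> :: "real \<Rightarrow> real \<Rightarrow> complex"
  assumes f: "cpt_integrable f" and g: "cpt_integrable g"
    and P: "{p. P (fst p) (snd p)} \<in> sets borel"
    and \<phi>: "continuous_on UNIV (\<lambda>p. \<phi> (fst p) (snd p))"
  shows "(LINT x|lebesgue. f x * (LINT y|lebesgue. (if P x y then g y * \<phi> x y else 0)))
       = (LINT y|lebesgue. g y * (LINT x|lebesgue. (if P x y then f x * \<phi> x y else 0)))"
    and "integrable lebesgue (\<lambda>x. f x * (LINT y|lebesgue. (if P x y then g y * \<phi> x y else 0)))"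
proof -
  obtain A where fi [measurable]: "integrable lebesgue f" and A: "\<And>x. f x \<noteq> 0 \<Longrightarrow> x \<in> {-A..A}"
    using cpt_integrableE[OF f] by blast
  obtain B where gi [measurable]: "integrable lebesgue g" and B: "\<And>x. g x \<noteq> 0 \<Longrightarrow> x \<in> {-B..B}"
    using cpt_integrableE[OF g] by blast
  have "compact ((\<lambda>p. \<phi> (fst p) (snd p)) ` ({-A..A} \<times> {-B..B}))"
    by (intro compact_continuous_image continuous_on_subset[OF \<phi>] compact_Times) auto
  then obtain C where "\<forall>z \<in> (\<lambda>p. \<phi> (fst p) (snd p)) ` ({-A..A} \<times> {-B..B}). norm z \<le> C"
    using compact_imp_bounded bounded_iff by metis
  then have C: "norm (\<phi> x y) \<le> C" if "f x \<noteq> 0" "g y \<noteq> 0" for x y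
    using A[OF that(1)] B[OF that(2)] by force
  let ?k = "\<lambda>x y. f x * (g y * (if P x y then \<phi> x y else 0))"
  have "(\<lambda>p. if P (fst p) (snd p) then \<phi> (fst p) (snd p) else 0) \<in> borel_measurable borel"
    using P borel_measurable_continuous_onI[OF \<phi>] by (intro measurable_If) (auto simp: pred_def)
  from measurable_compose[OF measurable_pair_lebesgue_borel this]
  have [measurable]: "(\<lambda>p. if P (fst p) (snd p) then \<phi> (fst p) (snd p) else 0)
      \<in> borel_measurable (lebesgue \<Otimes>\<^sub>M lebesgue)" .
  have fg: "integrable (lebesgue \<Otimes>\<^sub>M lebesgue) (\<lambda>p. f (fst p) * g (snd p))"
  proof (rule lebesgue_pair.Fubini_integrable)
    show "(\<lambda>p. f (fst p) * g (snd p)) \<in> borel_measurable (lebesgue \<Otimes>\<^sub>M lebesgue)"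
      by measurable
  qed (use fi gi in \<open>auto simp: norm_mult\<close>)
  have k: "integrable (lebesgue \<Otimes>\<^sub>M lebesgue) (case_prod ?k)"
  proof (rule Bochner_Integration.integrable_bound[of _ "\<lambda>p. of_real C * (f (fst p) * g (snd p))"])
    show "case_prod ?k \<in> borel_measurable (lebesgue \<Otimes>\<^sub>M lebesgue)"
      unfolding split_beta' by measurable
    have "norm (?k x y) \<le> norm (of_real C * (f x * g y))" for x y
    proof (cases "f x = 0 \<or> g y = 0")
      case False
      with C have "norm (\<phi> x y) \<le> \<bar>C\<bar>" by (metis abs_ge_self order_trans)
      then have "norm (f x * g y) * norm (if P x y then \<phi> x y else 0) \<le> norm (f x * g y) * \<bar>C\<bar>"
        by (intro mult_left_mono) auto
      then show ?thesis by (simp add: norm_mult mult_ac)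
    qed auto
    then show "AE p in lebesgue \<Otimes>\<^sub>M lebesgue. norm (case_prod ?k p) \<le> norm (of_real C * (f (fst p) * g (snd p)))"
      by (auto simp: split_beta)
  qed (use fg in auto)
  have 1: "(LINT y|lebesgue. ?k x y) = f x * (LINT y|lebesgue. (if P x y then g y * \<phi> x y else 0))" for x
  proof -
    have "?k x = (\<lambda>y. f x * (if P x y then g y * \<phi> x y else 0))" by auto
    then show ?thesis by simp
  qed
  have 2: "(LINT x|lebesgue. ?k x y) = g y * (LINT x|lebesgue. (if P x y then f x * \<phi> x y else 0))" for y
  proof -
    have "(\<lambda>x. ?k x y) = (\<lambda>x. g y * (if P x y then f x * \<phi> x y else 0))" by auto
    then show ?thesis by simp
  qed
  show "(LINT x|lebesgue. f x * (LINT y|lebesgue. (if P x y then g y * \<phi> x y else 0)))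
       = (LINT y|lebesgue. g y * (LINT x|lebesgue. (if P x y then f x * \<phi> x y else 0)))"
    using lebesgue_pair.Fubini_integral[OF k] unfolding 1 2 by simp
  show "integrable lebesgue (\<lambda>x. f x * (LINT y|lebesgue. (if P x y then g y * \<phi> x y else 0)))"
    using lebesgue_pair.integrable_fst'[OF k] unfolding split_beta fst_conv snd_conv 1 .
qed

lemma AE_lebesgue_neq: "AE t in lebesgue. t \<noteq> (x::real)"
  by (rule AE_I[of _ _ "{x}"]) (auto simp: emeasure_completion)

text \<open>Dominated convergence along a sequence tending to \<open>x\<close>: for each
  \<open>t \<noteq> x\<close> the truncated integrand is eventually constant along the sequence, and
  \<open>norm (f t)\<close> is a majorant.\<close>

lemma tail_integral_continuous:
  assumes f: "integrable lebesgue (f :: real \<Rightarrow> complex)"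
  shows "continuous_on UNIV (\<lambda>x. LINT t|lebesgue. (if x < t then f t else 0))"
    and "continuous_on UNIV (\<lambda>x. LINT t|lebesgue. (if t < x then f t else 0))"
proof -
  have [measurable]: "(\<lambda>x::real. x) \<in> borel_measurable lebesgue"
    by (rule borel_measurable_lebesgueI) simp
  have [measurable]: "f \<in> borel_measurable lebesgue" using f by auto
  have "(\<lambda>n. LINT t|lebesgue. (if u n < t then f t else 0)) \<longlonglongrightarrow> (LINT t|lebesgue. (if x < t then f t else 0))"
    "(\<lambda>n. LINT t|lebesgue. (if t < u n then f t else 0)) \<longlonglongrightarrow> (LINT t|lebesgue. (if t < x then f t else 0))"
    if "u \<longlonglongrightarrow> x" for u x
  proof -
    have *: "\<forall>\<^sub>F n in sequentially. (u n < t) = (x < t) \<and> (t < u n) = (t < x)" if "t \<noteq> x" for t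
    proof (cases "t < x")
      case True
      then show ?thesis using order_tendstoD(1)[OF \<open>u \<longlonglongrightarrow> x\<close> True] by (auto elim!: eventually_mono)
    next
      case False
      with that have "x < t" by simp
      then show ?thesis using order_tendstoD(2)[OF \<open>u \<longlonglongrightarrow> x\<close>, of t] by (auto elim!: eventually_mono)
    qed
    have L: "(\<lambda>n. if u n < t then f t else 0) \<longlonglongrightarrow> (if x < t then f t else 0)"
      "(\<lambda>n. if t < u n then f t else 0) \<longlonglongrightarrow> (if t < x then f t else 0)" if "t \<noteq> x" for t
      by (rule tendsto_eventually, rule eventually_mono[OF *[OF that]], simp)+
    have **: "AE t in lebesgue. (\<lambda>n. if u n < t then f t else 0) \<longlonglongrightarrow> (if x < t then f t else 0)"
      "AE t in lebesgue. (\<lambda>n. if t < u n then f t else 0) \<longlonglongrightarrow> (if t < x then f t else 0)"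
      by (rule AE_mp[OF AE_lebesgue_neq[of x]], rule AE_I2, rule impI, rule L, assumption)+
    show "(\<lambda>n. LINT t|lebesgue. (if u n < t then f t else 0)) \<longlonglongrightarrow> (LINT t|lebesgue. (if x < t then f t else 0))"
      by (rule integral_dominated_convergence[where w = "\<lambda>t. norm (f t)"]) (use f **(1) in auto)
    show "(\<lambda>n. LINT t|lebesgue. (if t < u n then f t else 0)) \<longlonglongrightarrow> (LINT t|lebesgue. (if t < x then f t else 0))"
      by (rule integral_dominated_convergence[where w = "\<lambda>t. norm (f t)"]) (use f **(2) in auto)
  qed
  then show "continuous_on UNIV (\<lambda>x. LINT t|lebesgue. (if x < t then f t else 0))"
    "continuous_on UNIV (\<lambda>x. LINT t|lebesgue. (if t < x then f t else 0))"
    by (auto simp: continuous_on_sequentially o_def)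
qed

lemma LINT_lebesgue_on:
  fixes f :: "real \<Rightarrow> complex"
  assumes "S \<in> sets lebesgue"
  shows "(LINT t|lebesgue_on S. f t) = (LINT t|lebesgue. (if t \<in> S then f t else 0))"
  using assms by (subst integral_restrict_space) (auto intro!: Bochner_Integration.integral_cong)

subsection \<open>Trigonometric kernels and convolutions\<close>

definition cs :: "complex \<Rightarrow> real \<Rightarrow> complex" where
  "cs l x = cos (csqrt l * of_real x)"

text \<open>The quotient is even in \<open>csqrt l\<close>, hence independent of the branch of the
  root; the value at \<open>l = 0\<close> is its limit.\<close>

definition sn :: "complex \<Rightarrow> real \<Rightarrow> complex" where
  "sn l x = (if l = 0 then of_real x else sin (csqrt l * of_real x) / csqrt l)"

text \<open>The primitive of \<open>- sn l / 2\<close> that vanishes at \<open>0\<close>; see \<open>sn_mult\<close>.\<close>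

definition ps :: "complex \<Rightarrow> real \<Rightarrow> complex" where
  "ps l x = (if l = 0 then - (of_real x)\<^sup>2 / 4 else (cos (csqrt l * of_real x) - 1) / (2 * l))"

lemma csqrt_mult_self: "csqrt l * csqrt l = l"
  by (metis power2_csqrt power2_eq_square)

lemma cs_0 [simp]: "cs l 0 = 1" and sn_0 [simp]: "sn l 0 = 0"
  by (auto simp: cs_def sn_def)

lemma sn_has_vector_derivative: "(sn l has_vector_derivative cs l x) (at x within S)"
proof (cases "l = 0")
  case True
  then show ?thesis
    unfolding sn_def[abs_def] cs_def by (auto intro!: derivative_eq_intros)
next
  case False
  have "((\<lambda>z. sin (csqrt l * z) / csqrt l) has_field_derivative cos (csqrt l * of_real x)) (at (of_real x))"
    using False by (auto intro!: derivative_eq_intros)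
  from has_field_derivative_subset[OF this, of "range of_real"]
  have "((\<lambda>x. sin (csqrt l * of_real x) / csqrt l) has_vector_derivative cos (csqrt l * of_real x)) (at x within S)"
    by (intro has_vector_derivative_real_field) (auto intro: DERIV_subset \<open>(_ has_field_derivative _) (at (of_real x))\<close>)
  then show ?thesis using False unfolding sn_def[abs_def] cs_def by simp
qed

lemma cs_has_vector_derivative: "(cs l has_vector_derivative - l * sn l x) (at x within S)"
proof -
  have d: "((\<lambda>z. cos (csqrt l * z)) has_field_derivative - sin (csqrt l * of_real x) * csqrt l) (at (of_real x))"
    by (auto intro!: derivative_eq_intros)
  have "- sin (csqrt l * of_real x) * csqrt l = - l * sn l x"
    using csqrt_mult_self[of l] by (auto simp: sn_def field_simps)
  then show ?thesis
    using has_vector_derivative_real_field[OF d] unfolding cs_def[abs_def]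
    by (metis has_vector_derivative_at_within)
qed

lemma ps_has_vector_derivative: "(ps l has_vector_derivative - sn l x / 2) (at x within S)"
proof (cases "l = 0")
  case True
  have "((\<lambda>z::complex. - z\<^sup>2 / 4) has_field_derivative - of_real x / 2) (at (of_real x))"
    by (auto intro!: derivative_eq_intros)
  from has_vector_derivative_real_field[OF this] show ?thesis
    using True unfolding ps_def[abs_def] sn_def by (auto intro: has_vector_derivative_at_within)
next
  case False
  have d: "((\<lambda>z. (cos (csqrt l * z) - 1) / (2 * l)) has_field_derivative - sin (csqrt l * of_real x) * csqrt l / (2 * l)) (at (of_real x))"
    using False by (auto intro!: derivative_eq_intros)
  have "- sin (csqrt l * of_real x) * csqrt l / (2 * l) = - sn l x / 2"
    using csqrt_mult_self[of l] False by (auto simp: sn_def field_simps)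
  then show ?thesis
    using has_vector_derivative_real_field[OF d] False unfolding ps_def[abs_def]
    by (simp only: if_False has_vector_derivative_at_within)
qed

lemma continuous_on_trig:
  shows continuous_on_sn: "continuous_on S f \<Longrightarrow> continuous_on S (\<lambda>x. sn l (f x))"
    and continuous_on_cs: "continuous_on S f \<Longrightarrow> continuous_on S (\<lambda>x. cs l (f x))"
    and continuous_on_ps: "continuous_on S f \<Longrightarrow> continuous_on S (\<lambda>x. ps l (f x))"
proof -
  have "continuous_on UNIV (sn l)" "continuous_on UNIV (cs l)" "continuous_on UNIV (ps l)"
    by (auto intro!: continuous_at_imp_continuous_on
        intro: sn_has_vector_derivative cs_has_vector_derivative ps_has_vector_derivative has_vector_derivative_continuous)
  then show "continuous_on S f \<Longrightarrow> continuous_on S (\<lambda>x. sn l (f x))"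
    "continuous_on S f \<Longrightarrow> continuous_on S (\<lambda>x. cs l (f x))"
    "continuous_on S f \<Longrightarrow> continuous_on S (\<lambda>x. ps l (f x))"
    by (auto intro: continuous_on_compose2)
qed

lemma sn_diff: "sn l (x - t) = sn l x * cs l t - cs l x * sn l t"
  by (auto simp: sn_def cs_def sin_diff right_diff_distrib diff_divide_distrib)

lemma cs_diff: "cs l (x - t) = cs l x * cs l t + l * sn l x * sn l t"
  using csqrt_mult_self[of l] by (auto simp: sn_def cs_def cos_diff right_diff_distrib field_simps)

text \<open>The product-to-sum formula divided by \<open>l\<close>, where the constant subtracted in
  \<open>ps\<close> cancels; for \<open>l = 0\<close> it is polarization of the square.\<close>

lemma sn_mult: "sn l A * sn l B = ps l (A - B) - ps l (A + B)"
proof (cases "l = 0")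
  case True
  then show ?thesis by (simp add: sn_def ps_def power2_eq_square field_simps)
next
  case False
  have *: "sin (csqrt l * of_real A) * sin (csqrt l * of_real B)
      = (cos (csqrt l * of_real (A - B)) - cos (csqrt l * of_real (A + B))) / 2"
    by (simp add: sin_times_sin distrib_left right_diff_distrib)
  have "sn l A * sn l B = sin (csqrt l * of_real A) * sin (csqrt l * of_real B) / (csqrt l * csqrt l)"
    using False by (simp add: sn_def)
  then show ?thesis using False unfolding csqrt_mult_self * by (simp add: ps_def diff_divide_distrib)
qed

lemma LINT_Ioc_eq_integral:
  fixes f :: "real \<Rightarrow> complex"
  assumes "continuous_on UNIV f"
  shows "(LINT u|lebesgue. (if A < u \<and> u \<le> B then f u else 0)) = integral {A..B} f"
    and "(LINT u|lebesgue. (if A \<le> u \<and> u \<le> B then f u else 0)) = integral {A..B} f"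
    and "(LINT u|lebesgue. (if A < u \<and> u < B then f u else 0)) = integral {A..B} f"
proof -
  have "integrable (lebesgue_on {A..B}) f"
    using continuous_imp_integrable_real continuous_on_subset[OF assms] by blast
  then have "(LINT u|lebesgue_on {A..B}. f u) = integral {A..B} f"
    by (rule lebesgue_integral_eq_integral) auto
  then show *: "(LINT u|lebesgue. (if A \<le> u \<and> u \<le> B then f u else 0)) = integral {A..B} f"
    by (simp add: LINT_lebesgue_on)
  have [measurable]: "f \<in> borel_measurable lebesgue" "(\<lambda>x::real. x) \<in> borel_measurable lebesgue"
    using assms by (auto intro!: borel_measurable_lebesgueI borel_measurable_continuous_onI)
  have "(LINT u|lebesgue. (if A < u \<and> u \<le> B then f u else 0)) = (LINT u|lebesgue. (if A \<le> u \<and> u \<le> B then f u else 0))"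
    by (rule integral_cong_AE, measurable) (use AE_lebesgue_neq[of A] in \<open>auto elim!: eventually_mono\<close>)
  with * show "(LINT u|lebesgue. (if A < u \<and> u \<le> B then f u else 0)) = integral {A..B} f" by simp
  have "(LINT u|lebesgue. (if A < u \<and> u < B then f u else 0)) = (LINT u|lebesgue. (if A \<le> u \<and> u \<le> B then f u else 0))"
    by (rule integral_cong_AE, measurable)
       (use AE_lebesgue_neq[of A] AE_lebesgue_neq[of B] in \<open>eventually_elim, auto\<close>)
  with * show "(LINT u|lebesgue. (if A < u \<and> u < B then f u else 0)) = integral {A..B} f" by simp
qed

lemma FTC_lebesgue:
  fixes F :: "real \<Rightarrow> complex"
  assumes "A \<le> B" "\<And>x. (F has_vector_derivative F' x) (at x)" "continuous_on UNIV F'"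
  shows "(LINT u|lebesgue. (if A < u \<and> u \<le> B then F' u else 0)) = F B - F A"
    and "(LINT u|lebesgue. (if A < u \<and> u < B then F' u else 0)) = F B - F A"
proof -
  have "integral {A..B} F' = F B - F A"
    by (intro integral_unique fundamental_theorem_of_calculus assms) (auto intro: has_vector_derivative_at_within assms)
  then show "(LINT u|lebesgue. (if A < u \<and> u \<le> B then F' u else 0)) = F B - F A"
    "(LINT u|lebesgue. (if A < u \<and> u < B then F' u else 0)) = F B - F A"
    by (simp_all only: LINT_Ioc_eq_integral[OF assms(3)])
qed

text \<open>For \<open>g\<close> vanishing on the negative axis this is the Volterra convolution
  over \<open>(0, x)\<close>; with \<open>\<phi> = sn l\<close> it is the response to the right-hand
  side \<open>g\<close> with zero initial data.\<close>

definition conv :: "(real \<Rightarrow> complex) \<Rightarrow> (real \<Rightarrow> complex) \<Rightarrow> real \<Rightarrow> complex" where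
  "conv g \<phi> x = (LINT t|lebesgue. (if t < x then g t * \<phi> (x - t) else 0))"

text \<open>Integrating \<open>\<phi>' (u - t)\<close> over \<open>t < u \<le> x\<close> gives
  \<open>\<phi> (x - t) - \<phi> 0\<close>; multiply by \<open>g t\<close>, integrate and exchange
  the order. Stated in integrated form, since \<open>g\<close> need not be continuous.\<close>

lemma conv_FTC:
  assumes g: "cpt_integrable g" "\<And>t. g t \<noteq> 0 \<Longrightarrow> 0 \<le> t"
    and \<phi>: "\<And>x. (\<phi> has_vector_derivative \<phi>' x) (at x)" "continuous_on UNIV \<phi>'"
  shows "conv g \<phi> x = \<phi> 0 * (LINT t|lebesgue. (if t < x then g t else 0))
      + (LINT u|lebesgue. (if 0 \<le> u \<and> u \<le> x then conv g \<phi>' u else 0))"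
proof -
  let ?I = "\<lambda>u. if 0 \<le> u \<and> u \<le> x then 1 else 0 :: complex"
  have c: "continuous_on UNIV (\<lambda>p. \<phi>' (snd p - fst p))"
    by (intro continuous_on_compose2[OF \<phi>(2)] continuous_intros) auto
  have P: "{p. fst p < snd p} \<in> sets (borel :: (real \<times> real) measure)"
    by (intro borel_open open_Collect_less continuous_intros)
  have "g t * (LINT u|lebesgue. (if t < u then ?I u * \<phi>' (u - t) else 0)) = (if t < x then g t * (\<phi> (x - t) - \<phi> 0) else 0)" for t
  proof (cases "g t = 0")
    case False
    \<comment> \<open>Now \<open>t < u\<close> implies \<open>0 \<le> u\<close>, so the cutoff
      \<open>?I\<close> imposes only \<open>u \<le> x\<close>.\<close>
    then have "t \<ge> 0" by (rule g)
    show ?thesis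
    proof (cases "t < x")
      case True
      have "(LINT u|lebesgue. (if t < u then ?I u * \<phi>' (u - t) else 0))
          = (LINT u|lebesgue. (if t < u \<and> u \<le> x then \<phi>' (u - t) else 0))"
        using \<open>t \<ge> 0\<close> by (intro Bochner_Integration.integral_cong) auto
      also have "\<dots> = \<phi> (x - t) - \<phi> (t - t)"
      proof (rule FTC_lebesgue(1)[where F = "\<lambda>u. \<phi> (u - t)"])
        show "((\<lambda>u. \<phi> (u - t)) has_vector_derivative \<phi>' (u - t)) (at u)" for u
        proof -
          have "((\<lambda>u. u - t) has_vector_derivative 1) (at u)" by (auto intro!: derivative_eq_intros)
          from vector_diff_chain_at[OF this \<phi>(1)] show ?thesis by (simp add: o_def)
        qed
        show "continuous_on UNIV (\<lambda>u. \<phi>' (u - t))"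
          by (intro continuous_on_compose2[OF \<phi>(2)] continuous_intros) auto
      qed (use True in auto)
      finally show ?thesis using True by simp
    next
      case False
      then have "(\<lambda>u. if t < u then ?I u * \<phi>' (u - t) else 0) = (\<lambda>u. 0)" by auto
      with False show ?thesis by simp
    qed
  qed auto
  with cpt_Fubini(1)[OF g(1) cpt_integrable_Icc[of 0 x] P c]
  have eq: "(LINT t|lebesgue. (if t < x then g t * (\<phi> (x - t) - \<phi> 0) else 0))
      = (LINT u|lebesgue. ?I u * conv g \<phi>' u)"
    unfolding conv_def by simp
  have c\<phi>: "continuous_on UNIV \<phi>"
    using \<phi>(1) by (auto intro!: continuous_at_imp_continuous_on intro: has_vector_derivative_continuous)
  have c\<phi>x: "continuous_on UNIV (\<lambda>t. \<phi> (x - t))"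
    by (intro continuous_on_compose2[OF c\<phi>] continuous_intros) auto
  have Lx: "{t. t < x} \<in> sets lebesgue"
    by (simp flip: lessThan_def)
  have 1: "integrable lebesgue (\<lambda>t. if t < x then g t * \<phi> (x - t) else 0)"
    "integrable lebesgue (\<lambda>t. if t < x then g t * \<phi> 0 else 0)"
    by (rule cpt_integrableD[OF cpt_integrable_if[OF cpt_integrable_mult[OF g(1)] Lx]],
        rule c\<phi>x continuous_on_const)+
  have "(LINT t|lebesgue. (if t < x then g t * (\<phi> (x - t) - \<phi> 0) else 0))
      = (LINT t|lebesgue. (if t < x then g t * \<phi> (x - t) else 0) - (if t < x then g t * \<phi> 0 else 0))"
    by (intro Bochner_Integration.integral_cong) (auto simp: algebra_simps)
  also have "\<dots> = conv g \<phi> x - (LINT t|lebesgue. (if t < x then g t * \<phi> 0 else 0))"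
    unfolding conv_def by (rule Bochner_Integration.integral_diff[OF 1])
  also have "(LINT t|lebesgue. (if t < x then g t * \<phi> 0 else 0)) = (LINT t|lebesgue. \<phi> 0 * (if t < x then g t else 0))"
    by (intro Bochner_Integration.integral_cong) auto
  finally have "conv g \<phi> x = \<phi> 0 * (LINT t|lebesgue. (if t < x then g t else 0)) + (LINT u|lebesgue. ?I u * conv g \<phi>' u)"
    unfolding eq by (simp add: algebra_simps)
  also have "(\<lambda>u. ?I u * conv g \<phi>' u) = (\<lambda>u. if 0 \<le> u \<and> u \<le> x then conv g \<phi>' u else 0)"
    by auto
  finally show ?thesis .
qed

text \<open>The addition formulas pull \<open>x\<close> out of the kernel, leaving \<open>x\<close>
  only in continuous prefactors and in the limit of integrals covered by
  \<open>tail_integral_continuous\<close>.\<close>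

lemma conv_trig_continuous:
  assumes g: "cpt_integrable g"
  shows "continuous_on UNIV (conv g (sn l))" "continuous_on UNIV (conv g (cs l))"
proof -
  let ?C = "\<lambda>x. LINT t|lebesgue. (if t < x then g t * cs l t else 0)"
  let ?S = "\<lambda>x. LINT t|lebesgue. (if t < x then g t * sn l t else 0)"
  have i: "cpt_integrable (\<lambda>t. g t * cs l t)" "cpt_integrable (\<lambda>t. g t * sn l t)"
    by (intro cpt_integrable_mult g continuous_on_trig continuous_on_id)+
  then have c: "continuous_on UNIV ?C" "continuous_on UNIV ?S"
    by (auto intro: tail_integral_continuous)
  have i': "integrable lebesgue (\<lambda>t. if t < x then g t * cs l t else 0)"
    "integrable lebesgue (\<lambda>t. if t < x then g t * sn l t else 0)" for x
    by (rule cpt_integrableD, rule cpt_integrable_if, rule i, simp flip: lessThan_def)+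
  have "conv g (sn l) x = sn l x * ?C x - cs l x * ?S x" for x
    unfolding conv_def integral_mult_right_zero[symmetric]
    by (subst Bochner_Integration.integral_diff[symmetric])
       (auto intro!: Bochner_Integration.integral_cong i' simp: sn_diff algebra_simps)
  moreover have "conv g (cs l) x = cs l x * ?C x + (l * sn l x) * ?S x" for x
    unfolding conv_def integral_mult_right_zero[symmetric]
    by (subst Bochner_Integration.integral_add[symmetric])
       (auto intro!: Bochner_Integration.integral_cong i' simp: cs_diff algebra_simps)
  ultimately have "conv g (sn l) = (\<lambda>x. sn l x * ?C x - cs l x * ?S x)"
    "conv g (cs l) = (\<lambda>x. cs l x * ?C x + (l * sn l x) * ?S x)"
    by auto
  then show "continuous_on UNIV (conv g (sn l))" "continuous_on UNIV (conv g (cs l))"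
    by (auto intro!: continuous_intros continuous_on_trig c)
qed

subsection \<open>The initial value problem\<close>

lemma D_pi_eqI: "x \<in> {0..pi} \<Longrightarrow> (y has_vector_derivative d) (at x within {0..pi}) \<Longrightarrow> D_pi y x = d"
  unfolding D_pi_def by (intro vector_derivative_within_closed_interval) auto

text \<open>Two uses of \<open>conv_FTC\<close>: with \<open>sn l\<close> it gives
  \<open>y' = cs l + conv g (cs l)\<close>, and with \<open>cs l\<close> it exhibits this derivative
  as a primitive of \<open>g - l * y\<close>. The function \<open>g\<close> stands for the delayed
  term \<open>q x * y (x - a)\<close>.\<close>

lemma variation_of_constants:
  assumes g: "cpt_integrable g" "\<And>t. g t \<noteq> 0 \<Longrightarrow> 0 \<le> t"
    and y: "\<And>x. x \<in> {0..pi} \<Longrightarrow> y x = sn l x + conv g (sn l) x"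
    and q: "\<And>x. 0 < x \<Longrightarrow> x < pi \<Longrightarrow> g x = q x * y (x - a)"
  shows "is_solution a q l y" "y 0 = 0" "D_pi y 0 = 1"
proof -
  have cV: "continuous_on UNIV (conv g (sn l))" and cW: "continuous_on UNIV (conv g (cs l))"
    by (rule conv_trig_continuous[OF g(1)])+
  \<comment> \<open>Because \<open>sn l 0 = 0\<close>, \<open>conv_FTC\<close> leaves no boundary
    term.\<close>
  have V: "conv g (sn l) x = integral {0..x} (conv g (cs l))" for x
    using conv_FTC[OF g sn_has_vector_derivative, of l x] LINT_Ioc_eq_integral(2)[OF cW, of 0 x]
      continuous_on_cs[OF continuous_on_id, of UNIV l] by simp
  have dV: "((\<lambda>x. integral {0..x} (conv g (cs l))) has_vector_derivative conv g (cs l) x) (at x within {0..pi})"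
    if "x \<in> {0..pi}" for x
    by (rule integral_has_vector_derivative[OF continuous_on_subset[OF cW] that]) auto
  have dy: "(y has_vector_derivative cs l x + conv g (cs l) x) (at x within {0..pi})" if "x \<in> {0..pi}" for x
  proof (rule has_vector_derivative_transform[OF that])
    show "((\<lambda>x. sn l x + integral {0..x} (conv g (cs l))) has_vector_derivative cs l x + conv g (cs l) x) (at x within {0..pi})"
      by (intro has_vector_derivative_add sn_has_vector_derivative dV that)
  qed (use y V in auto)
  have D: "D_pi y x = cs l x + conv g (cs l) x" if "x \<in> {0..pi}" for x
    using D_pi_eqI[OF that dy[OF that]] .
  have V0: "conv g \<phi> 0 = 0" for \<phi>
  proof -
    have "(\<lambda>t. if t < 0 then g t * \<phi> (0 - t) else 0) = (\<lambda>t. 0)"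
      using g(2) by force
    then show ?thesis unfolding conv_def by simp
  qed
  show "y 0 = 0" using y[of 0] V0 by simp
  show D0: "D_pi y 0 = 1" using D[of 0] V0 by simp
  \<comment> \<open>The function \<open>h\<close> is the formula for \<open>y\<close>, continuous on
    the whole line, whereas \<open>y\<close> is controlled only on \<open>[0, pi]\<close>;
    \<open>w\<close> is the second derivative dictated by the equation.\<close>
  define h where "h = (\<lambda>t. sn l t + conv g (sn l) t)"
  define w where "w = (\<lambda>t. g t - l * y t)"
  have ch: "continuous_on UNIV (\<lambda>t. - l * h t)"
    unfolding h_def by (intro continuous_intros continuous_on_sn cV)
  have wh: "w t = g t + (- l * h t)" if "t \<in> {0..pi}" for t
    using y[OF that] by (simp add: w_def h_def)
  have Icc: "cpt_integrable (\<lambda>t. (if 0 \<le> t \<and> t \<le> x then 1 else 0) * (- l * h t))" for x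
    by (rule cpt_integrable_mult[OF cpt_integrable_Icc ch])
  have ih: "integrable lebesgue (\<lambda>t. if 0 \<le> t \<and> t \<le> x then - l * h t else 0)" for x
    by (rule cpt_integrableD[OF Icc[of x], THEN Bochner_Integration.integrable_cong[OF refl, THEN iffD1, rotated]]) auto
  have ig: "integrable lebesgue (\<lambda>t. if 0 \<le> t \<and> t \<le> x then g t else 0)" for x
    by (rule cpt_integrableD[OF cpt_integrable_if[OF g(1)]]) (simp flip: atLeastAtMost_def atLeastAtMost_iff)
  have wif: "(\<lambda>t. if t \<in> {0..x} then w t else 0)
      = (\<lambda>t. (if 0 \<le> t \<and> t \<le> x then g t else 0) + (if 0 \<le> t \<and> t \<le> x then - l * h t else 0))"
    if "x \<in> {0..pi}" for x
    using that wh by (auto simp: fun_eq_iff)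
  have iw: "integrable (lebesgue_on {0..pi}) w"
    by (subst Lebesgue_Measure.integrable_restrict_UNIV[symmetric])
       (auto simp: wif[of pi, simplified] intro!: Bochner_Integration.integrable_add ih ig)
  have "D_pi y x = D_pi y 0 + (LINT t|lebesgue_on {0..x}. w t)" if x: "x \<in> {0..pi}" for x
  proof -
    have [measurable]: "g \<in> borel_measurable lebesgue" "(\<lambda>x::real. x) \<in> borel_measurable lebesgue"
      using g(1) by (auto intro: borel_measurable_lebesgueI)
    have Ga: "AE t in lebesgue. (if t < x then g t else 0) = (if 0 \<le> t \<and> t \<le> x then g t else 0)"
      using AE_lebesgue_neq[of x] by eventually_elim (use g(2) in force)
    have G: "(LINT t|lebesgue. (if t < x then g t else 0)) = (LINT t|lebesgue. (if 0 \<le> t \<and> t \<le> x then g t else 0))"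
      by (rule integral_cong_AE[OF _ _ Ga]; measurable)
    have cc: "continuous_on UNIV (\<lambda>t. - l * sn l t)"
      by (intro continuous_intros continuous_on_sn)
    have conv_eq: "conv g (\<lambda>t. - l * sn l t) = (\<lambda>u. - l * conv g (sn l) u)"
    proof
      fix u
      have "(\<lambda>t. if t < u then g t * (- l * sn l (u - t)) else 0) = (\<lambda>t. - l * (if t < u then g t * sn l (u - t) else 0))"
        by auto
      then show "conv g (\<lambda>t. - l * sn l t) u = - l * conv g (sn l) u"
        unfolding conv_def by (simp only: integral_mult_right_zero)
    qed
    \<comment> \<open>Here \<open>cs l 0 = 1\<close>, so the boundary term survives and contributes
      the primitive of \<open>g\<close>.\<close>
    have W: "conv g (cs l) x = (LINT t|lebesgue. (if t < x then g t else 0))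
        + integral {0..x} (\<lambda>u. - l * conv g (sn l) u)"
    proof -
      have "conv g (cs l) x = cs l 0 * (LINT t|lebesgue. (if t < x then g t else 0))
          + (LINT u|lebesgue. (if 0 \<le> u \<and> u \<le> x then conv g (\<lambda>t. - l * sn l t) u else 0))"
        by (rule conv_FTC[OF g cs_has_vector_derivative cc])
      also have "(LINT u|lebesgue. (if 0 \<le> u \<and> u \<le> x then conv g (\<lambda>t. - l * sn l t) u else 0))
          = integral {0..x} (\<lambda>u. - l * conv g (sn l) u)"
        unfolding conv_eq by (rule LINT_Ioc_eq_integral(2)) (intro continuous_intros cV)
      finally show ?thesis by simp
    qed
    have C: "integral {0..x} (\<lambda>t. - l * sn l t) = cs l x - 1"
    proof (rule integral_unique)
      show "((\<lambda>t. - l * sn l t) has_integral cs l x - 1) {0..x}"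
        using fundamental_theorem_of_calculus[OF _ cs_has_vector_derivative, of 0 x l] x by simp
    qed
    have "integral {0..x} (\<lambda>t. - l * h t) = integral {0..x} (\<lambda>t. - l * sn l t + - l * conv g (sn l) t)"
      by (simp add: h_def algebra_simps)
    also have "\<dots> = integral {0..x} (\<lambda>t. - l * sn l t) + integral {0..x} (\<lambda>u. - l * conv g (sn l) u)"
      by (rule Henstock_Kurzweil_Integration.integral_add)
         (rule integrable_continuous_real, intro continuous_intros continuous_on_sn continuous_on_subset[OF cV]; simp)+
    finally have hA: "integral {0..x} (\<lambda>t. - l * h t) = \<dots>" .
    have hB: "(LINT t|lebesgue_on {0..x}. w t)
       = (LINT t|lebesgue. (if 0 \<le> t \<and> t \<le> x then g t else 0)) + integral {0..x} (\<lambda>t. - l * h t)"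
      by (simp only: LINT_lebesgue_on atLeastAtMost_borel fmeasurableD lmeasurable_interval wif[OF x]
          Bochner_Integration.integral_add[OF ig ih] LINT_Ioc_eq_integral(2)[OF ch])
    show ?thesis unfolding D[OF x] D0 W G hB hA C by simp
  qed
  moreover have "y differentiable_on {0..pi}"
    unfolding differentiable_on_def using dy differentiableI_vector by blast
  moreover have "AE x in lebesgue_on {0<..<pi}. - w x + q x * y (x - a) = l * y x"
    by (rule AE_I2) (auto simp: w_def q space_restrict_space)
  ultimately show "is_solution a q l y"
    unfolding is_solution_def using iw by blast
qed

text \<open>For fixed \<open>x\<close>, the combination \<open>F\<close> of the solution with
  \<open>sn l (x - t)\<close> and \<open>cs l (x - t)\<close> has derivative zero in
  \<open>t\<close>. It equals \<open>z x\<close> at \<open>t = x\<close> and \<open>0\<close> at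
  \<open>t = 0\<close>.\<close>

lemma homogeneous_zero:
  fixes z d :: "real \<Rightarrow> complex"
  assumes z: "\<And>x. x \<in> {0..T} \<Longrightarrow> (z has_vector_derivative d x) (at x within {0..T})"
    and d: "\<And>x. x \<in> {0..T} \<Longrightarrow> (d has_vector_derivative - l * z x) (at x within {0..T})"
    and 0: "z 0 = 0" "d 0 = 0" and x: "x \<in> {0..T}"
  shows "z x = 0"
proof -
  define F where "F = (\<lambda>t. d t * sn l (x - t) + z t * cs l (x - t))"
  have "(F has_vector_derivative 0) (at t within {0..x})" if t: "t \<in> {0..x}" for t
  proof -
    have u: "((\<lambda>t. x - t) has_vector_derivative -1) (at t within {0..x})"
      by (auto intro!: derivative_eq_intros)
    have s: "((\<lambda>t. sn l (x - t)) has_vector_derivative - cs l (x - t)) (at t within {0..x})"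
      using vector_diff_chain_within[OF u sn_has_vector_derivative, of l] by (simp add: o_def)
    have c: "((\<lambda>t. cs l (x - t)) has_vector_derivative l * sn l (x - t)) (at t within {0..x})"
      using vector_diff_chain_within[OF u cs_has_vector_derivative, of l] by (simp add: o_def)
    have sub: "{0..x} \<subseteq> {0..T}" "t \<in> {0..T}" using x t by auto
    note z' = has_vector_derivative_within_subset[OF z[OF sub(2)] sub(1)]
    note d' = has_vector_derivative_within_subset[OF d[OF sub(2)] sub(1)]
    show ?thesis unfolding F_def
      by (rule has_vector_derivative_eq_rhs[OF has_vector_derivative_add[OF
            has_vector_derivative_mult[OF d' s] has_vector_derivative_mult[OF z' c]]])
         (simp add: algebra_simps)
  qed
  then obtain k where k: "\<And>t. t \<in> {0..x} \<Longrightarrow> F t = k"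
    using has_vector_derivative_zero_constant[of "{0..x}" F] by auto
  have "F x = F 0" using k[of x] k[of 0] x by simp
  then show ?thesis using 0 by (simp add: F_def)
qed

text \<open>Method of steps: once the difference \<open>z\<close> vanishes on
  \<open>[0, n*a]\<close>, the delayed term drops out on the next interval of length
  \<open>a\<close>, and \<open>homogeneous_zero\<close> applies. On the first interval the delayed
  term is removed by \<open>q = 0\<close> on \<open>(0, a)\<close>.\<close>

lemma solution_unique:
  assumes a: "0 < a" and q: "\<And>x. 0 < x \<Longrightarrow> x < a \<Longrightarrow> q x = 0"
    and 1: "is_solution a q l y1" and 2: "is_solution a q l y2"
    and 0: "y1 0 = y2 0" "D_pi y1 0 = D_pi y2 0"
    and x: "x \<in> {0..pi}"
  shows "y1 x = y2 x"
proof -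
  obtain w1 where w1: "integrable (lebesgue_on {0..pi}) w1"
    "\<And>x. x \<in> {0..pi} \<Longrightarrow> D_pi y1 x = D_pi y1 0 + (LINT t|lebesgue_on {0..x}. w1 t)"
    "AE x in lebesgue_on {0<..<pi}. - w1 x + q x * y1 (x - a) = l * y1 x"
    using 1 unfolding is_solution_def by blast
  obtain w2 where w2: "integrable (lebesgue_on {0..pi}) w2"
    "\<And>x. x \<in> {0..pi} \<Longrightarrow> D_pi y2 x = D_pi y2 0 + (LINT t|lebesgue_on {0..x}. w2 t)"
    "AE x in lebesgue_on {0<..<pi}. - w2 x + q x * y2 (x - a) = l * y2 x"
    using 2 unfolding is_solution_def by blast
  define z where "z = (\<lambda>x. y1 x - y2 x)"
  define d where "d = (\<lambda>x. D_pi y1 x - D_pi y2 x)"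
  have dz: "(z has_vector_derivative d x) (at x within {0..pi})" if "x \<in> {0..pi}" for x
  proof -
    have "(y has_vector_derivative D_pi y x) (at x within {0..pi})" if "is_solution a q l y" for y
      using that \<open>x \<in> {0..pi}\<close> unfolding D_pi_def is_solution_def differentiable_on_def
      by (simp add: vector_derivative_works)
    from has_vector_derivative_diff[OF this[OF 1] this[OF 2]] show ?thesis
      unfolding z_def d_def .
  qed
  then have cz: "continuous_on {0..pi} z"
    unfolding continuous_on_eq_continuous_within by (metis has_vector_derivative_continuous)
  have sub: "integrable (lebesgue_on {0..x}) w" if "integrable (lebesgue_on {0..pi}) w" "x \<in> {0..pi}" for w :: "real \<Rightarrow> complex" and x
  proof -
    have "integrable lebesgue (\<lambda>t. indicator {0..x} t *\<^sub>R (if t \<in> {0..pi} then w t else 0))"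
      by (intro integrable_mult_indicator Lebesgue_Measure.integrable_restrict_UNIV[THEN iffD2] that) auto
    moreover have "(\<lambda>t. indicator {0..x} t *\<^sub>R (if t \<in> {0..pi} then w t else 0)) = (\<lambda>t. if t \<in> {0..x} then w t else 0)"
      using that by (auto simp: indicator_def fun_eq_iff)
    ultimately show ?thesis
      by (intro Lebesgue_Measure.integrable_restrict_UNIV[THEN iffD1]) auto
  qed
  have z0: "\<forall>x\<in>{0..min pi (real n * a)}. z x = 0" for n
  proof (induction n)
    case 0
    then show ?case using \<open>y1 0 = y2 0\<close> by (auto simp: z_def)
  next
    case (Suc n)
    define T where "T = min pi (real (Suc n) * a)"
    have T: "0 \<le> T" "T \<le> pi" using a by (auto simp: T_def)
    have ae: "AE t in lebesgue. 0 < t \<and> t < T \<longrightarrow> w1 t - w2 t = - l * z t"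
    proof -
      have "AE t in lebesgue. t \<in> {0<..<pi} \<longrightarrow> - w1 t + q t * y1 (t - a) = l * y1 t"
        "AE t in lebesgue. t \<in> {0<..<pi} \<longrightarrow> - w2 t + q t * y2 (t - a) = l * y2 t"
        using w1(3) w2(3) by (simp_all add: AE_restrict_space_iff)
      then show ?thesis
      proof eventually_elim
        case (elim t)
        show ?case
        proof
          assume t: "0 < t \<and> t < T"
          have "q t * z (t - a) = 0"
          proof (cases "t < a")
            case True then show ?thesis using q t by simp
          next
            case False
            then have "t - a \<in> {0..min pi (real n * a)}"
              using t a T by (auto simp: T_def algebra_simps)
            then show ?thesis using Suc.IH by simp
          qed
          then have eq: "q t * y1 (t - a) = q t * y2 (t - a)"
            by (auto simp: z_def)
          have "w1 t = q t * y1 (t - a) - l * y1 t" "w2 t = q t * y2 (t - a) - l * y2 t"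
            using elim t T by (simp_all add: field_simps)
          then show "w1 t - w2 t = - l * z t" unfolding eq by (simp add: z_def algebra_simps)
        qed
      qed
    qed
    \<comment> \<open>The integrand \<open>w1 - w2\<close> agrees almost everywhere with the
      continuous function \<open>- l * z\<close>; hence \<open>d\<close> is differentiable at every
      point, as \<open>homogeneous_zero\<close> demands.\<close>
    have d: "d x = integral {0..x} (\<lambda>t. - l * z t)" if "x \<in> {0..T}" for x
    proof -
      have x: "x \<in> {0..pi}" using that T by auto
      have cx: "continuous_on {0..x} (\<lambda>t. - l * z t)"
        using x by (intro continuous_intros continuous_on_subset[OF cz]) auto
      note i = sub[OF w1(1) x] sub[OF w2(1) x]
      have iz: "integrable (lebesgue_on {0..x}) (\<lambda>t. - l * z t)"
        by (rule continuous_imp_integrable_real[OF cx])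
      have "d x = (LINT t|lebesgue_on {0..x}. w1 t - w2 t)"
        unfolding d_def w1(2)[OF x] w2(2)[OF x] using i 0 by simp
      also have "\<dots> = (LINT t|lebesgue_on {0..x}. - l * z t)"
      proof (rule integral_cong_AE)
        show "AE t in lebesgue_on {0..x}. w1 t - w2 t = - l * z t"
          unfolding AE_restrict_space_iff[of "{0..x}" lebesgue, simplified]
          using ae AE_lebesgue_neq[of 0] AE_lebesgue_neq[of x]
          by eventually_elim (use that in auto)
      qed (use i iz in auto)
      also have "\<dots> = integral {0..x} (\<lambda>t. - l * z t)"
        by (rule lebesgue_integral_eq_integral[OF iz]) auto
      finally show ?thesis .
    qed
    have cT: "continuous_on {0..T} (\<lambda>t. - l * z t)"
      using T by (intro continuous_intros continuous_on_subset[OF cz]) auto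
    show ?case unfolding T_def[symmetric]
    proof
      fix x assume x: "x \<in> {0..T}"
      show "z x = 0"
      proof (rule homogeneous_zero[OF _ _ _ _ x])
        show "(z has_vector_derivative d x) (at x within {0..T})" if "x \<in> {0..T}" for x
          by (rule has_vector_derivative_within_subset[OF dz]) (use that T in auto)
        show "(d has_vector_derivative - l * z x) (at x within {0..T})" if "x \<in> {0..T}" for x
          by (rule has_vector_derivative_transform[OF that d integral_has_vector_derivative[OF cT that]])
      qed (use 0 in \<open>auto simp: z_def d_def\<close>)
    qed
  qed
  obtain n where "pi / a \<le> real n" using real_arch_simple by blast
  then have "pi \<le> real n * a" using a by (simp add: field_simps)
  with z0[of n] x show ?thesis by (auto simp: z_def)
qed

lemma y_one_eqI:
  assumes "0 < a" "\<And>x. 0 < x \<Longrightarrow> x < a \<Longrightarrow> q x = 0"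
    and "y \<in> extensional {0..pi}" "is_solution a q l y" "y 0 = 0" "D_pi y 0 = 1"
  shows "y_one a q l = y"
  unfolding y_one_def
proof (rule the_equality)
  fix y' assume y': "y' \<in> extensional {0..pi} \<and> is_solution a q l y' \<and> y' 0 = 0 \<and> D_pi y' 0 = 1"
  show "y' = y"
    by (rule extensionalityI[of _ "{0..pi}"]) (use assms y' solution_unique[of a q l y' y] in auto)
qed (use assms in auto)

section \<open>Picard iteration for the delay equation\<close>

lemma conv_cong:
  assumes "\<And>t. t < x \<Longrightarrow> g t = g' t"
  shows "conv g \<phi> x = conv g' \<phi> x"
  unfolding conv_def using assms by (intro Bochner_Integration.integral_cong) auto

text \<open>First iterate, starting from \<open>sn l\<close>, for the integral equation
  \<open>y = sn l + conv (\<lambda>t. q t * y (t - a)) (sn l)\<close>.\<close>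

definition picard1 :: "real \<Rightarrow> (real \<Rightarrow> complex) \<Rightarrow> complex \<Rightarrow> real \<Rightarrow> complex" where
  "picard1 a q l x = sn l x + conv (\<lambda>t. q t * sn l (t - a)) (sn l) x"

definition picard2 :: "real \<Rightarrow> (real \<Rightarrow> complex) \<Rightarrow> complex \<Rightarrow> real \<Rightarrow> complex" where
  "picard2 a q l x = sn l x + conv (\<lambda>t. q t * picard1 a q l (t - a)) (sn l) x"

lemma picard_integrable:
  assumes "cpt_integrable q"
  shows "cpt_integrable (\<lambda>t. q t * sn l (t - a))" "cpt_integrable (\<lambda>t. q t * picard1 a q l (t - a))"
proof -
  show 1: "cpt_integrable (\<lambda>t. q t * sn l (t - a))"
    by (intro cpt_integrable_mult assms continuous_on_sn continuous_intros)
  have "continuous_on UNIV (picard1 a q l)"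
    unfolding picard1_def[abs_def] by (intro continuous_intros continuous_on_sn conv_trig_continuous 1)
  then have "continuous_on UNIV (\<lambda>t. picard1 a q l (t - a))"
    by (rule continuous_on_compose2) (auto intro!: continuous_intros)
  then show "cpt_integrable (\<lambda>t. q t * picard1 a q l (t - a))"
    by (rule cpt_integrable_mult[OF assms])
qed

text \<open>Since the delay is \<open>a\<close> and the potential lives on \<open>(3a/2, 3a)\<close>, the Picard iteration
  is stationary after two steps.\<close>

lemma y_one_eq_picard2:
  assumes a: "0 < a" and q: "cpt_integrable q" and supp: "\<And>x. q x \<noteq> 0 \<Longrightarrow> 3 * a / 2 < x \<and> x < 3 * a"
  shows "y_one a q l = restrict (picard2 a q l) {0..pi}"
    and "is_solution a q l (restrict (picard2 a q l) {0..pi})"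
proof -
  let ?y = "restrict (picard2 a q l) {0..pi}"
  have z1: "conv (\<lambda>t. q t * sn l (t - a)) (sn l) x = 0" if "x < a" for x
  proof -
    have "conv (\<lambda>t. q t * sn l (t - a)) (sn l) x = conv (\<lambda>t. 0) (sn l) x"
      using supp that a by (intro conv_cong) force
    then show ?thesis by (simp add: conv_def cong: if_cong)
  qed
  \<comment> \<open>For \<open>t < x < 2*a\<close> the delayed argument \<open>t - a\<close> is
    below \<open>a\<close>, where \<open>z1\<close> reduces \<open>picard1\<close> to
    \<open>sn l\<close>.\<close>
  have eq: "picard1 a q l x = picard2 a q l x" if "x < 2 * a" for x
    unfolding picard2_def picard1_def[of _ _ _ x]
    using that by (intro arg_cong[where f = "(+) _"] conv_cong) (simp add: picard1_def z1)
  \<comment> \<open>On the support of \<open>q\<close> the point \<open>x - a\<close> lies in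
    \<open>(a/2, 2*a)\<close>, so both iterates agree there; hence \<open>picard2\<close> solves the
    integral equation.\<close>
  have *: "q x * picard1 a q l (x - a) = q x * ?y (x - a)" if "0 < x" "x < pi" for x
    using supp[of x] eq[of "x - a"] that a by (cases "q x = 0") auto
  have supp': "q t * picard1 a q l (t - a) \<noteq> 0 \<Longrightarrow> 0 \<le> t" for t
    using supp[of t] a by auto
  note sol = variation_of_constants[OF picard_integrable(2)[OF q, of a l] supp', of ?y l q a]
  have "is_solution a q l ?y" "?y 0 = 0" "D_pi ?y 0 = 1"
    by (rule sol; (rule *; assumption)?; simp add: picard2_def)+
  then show "is_solution a q l ?y" "y_one a q l = ?y"
    using supp a by (auto intro!: y_one_eqI) force
qed

text \<open>For \<open>j = 0, 1\<close> only the value and the one-sided derivative of the solution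
  at \<open>pi\<close> matter, and both are determined by its values on
  \<open>[c, pi]\<close>.\<close>

lemma char_fun_eqI:
  assumes a: "0 < a" and c: "c < pi"
    and q: "cpt_integrable q" "\<And>x. q x \<noteq> 0 \<Longrightarrow> 3 * a / 2 < x \<and> x < 3 * a"
    and q': "cpt_integrable q'" "\<And>x. q' x \<noteq> 0 \<Longrightarrow> 3 * a / 2 < x \<and> x < 3 * a"
    and eq: "\<And>x. c \<le> x \<Longrightarrow> picard2 a q l x = picard2 a q' l x"
    and j: "j \<in> {0, 1}"
  shows "char_fun j a q l = char_fun j a q' l"
proof -
  define y where "y = restrict (picard2 a q l) {0..pi}"
  define y' where "y' = restrict (picard2 a q' l) {0..pi}"
  have Y: "y_one a q l = y" "y_one a q' l = y'" "is_solution a q l y"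
    unfolding y_def y'_def using y_one_eq_picard2[OF a q] y_one_eq_picard2(1)[OF a q'] by auto
  have e: "y x = y' x" if "c \<le> x" for x
    unfolding y_def y'_def using eq[OF that] by (simp add: restrict_def)
  have "(y has_vector_derivative D_pi y pi) (at pi within {0..pi})"
    using Y(3) unfolding D_pi_def is_solution_def differentiable_on_def
    by (simp add: vector_derivative_works)
  then have "(y' has_vector_derivative D_pi y pi) (at pi within {0..pi})"
    by (rule has_vector_derivative_transform_within[where d = "pi - c"])
       (use c e in \<open>auto simp: dist_real_def\<close>)
  then have "D_pi y' pi = D_pi y pi" by (intro D_pi_eqI) auto
  with j e[of pi] c Y show ?thesis unfolding char_fun_def by auto
qed

subsection \<open>Cancellation of the terms linear in \<open>\<alpha>\<close>\<close>

lemma lebesgue_integral_shift: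
  fixes f :: "real \<Rightarrow> complex"
  assumes "f \<in> borel_measurable borel"
  shows "(LINT u|lebesgue. f u) = (LINT v|lebesgue. f (v + c))"
proof -
  have "(LINT u|lborel. f u) = (LINT v|lborel. f (v + c))"
    using lborel_integral_real_affine[of 1 f c] by (simp add: add.commute)
  then show ?thesis using assms by (simp add: integral_completion)
qed

text \<open>Here \<open>e\<close> and \<open>H\<close> stand for \<open>e0\<close> and
  \<open>h0\<close> extended by zero, so all integrals run over the line. The lower limit in
  \<open>M_op\<close> is carried by the support of \<open>e\<close>, the upper one by that of
  \<open>H\<close>: the inner integral vanishes once \<open>v + t - a/2 \<ge> 3*a\<close>.\<close>

locale eigenpair =
  fixes a :: real and e H :: "real \<Rightarrow> complex"
  assumes a: "0 < a"
    and e: "cpt_integrable e" and esupp: "\<And>t. e t \<noteq> 0 \<Longrightarrow> 3 * a / 2 < t \<and> t < 2 * a"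
    and H: "cpt_integrable H" and Hsupp: "\<And>t. H t \<noteq> 0 \<Longrightarrow> 5 * a / 2 < t \<and> t < 3 * a"
    and eigen: "AE v in lebesgue. 3 * a / 2 < v \<and> v < 2 * a \<longrightarrow>
        (LINT t|lebesgue. (LINT s|lebesgue. (if v + t - a / 2 < s then H s else 0)) * e t) = e v"
begin

definition K :: "real \<Rightarrow> complex" where
  "K x = (LINT s|lebesgue. (if x < s then H s else 0))"

definition E :: "real \<Rightarrow> complex" where
  "E x = (LINT t|lebesgue. (if t < x then e t else 0))"

lemma K_zero: "3 * a \<le> x \<Longrightarrow> K x = 0"
proof -
  assume "3 * a \<le> x"
  then have "(\<lambda>s. if x < s then H s else 0) = (\<lambda>s. 0)" using Hsupp by force
  then show ?thesis by (simp add: K_def)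
qed

lemma E_zero: "x \<le> 3 * a / 2 \<Longrightarrow> E x = 0"
proof -
  assume "x \<le> 3 * a / 2"
  then have "(\<lambda>t. if t < x then e t else 0) = (\<lambda>t. 0)" using esupp by force
  then show ?thesis by (simp add: E_def)
qed

lemma continuous_K: "continuous_on S f \<Longrightarrow> continuous_on S (\<lambda>x. K (f x))"
  using tail_integral_continuous(1)[OF cpt_integrableD[OF H]] unfolding K_def
  by (rule continuous_on_compose2) auto

lemma continuous_E: "continuous_on S f \<Longrightarrow> continuous_on S (\<lambda>x. E (f x))"
  using tail_integral_continuous(2)[OF cpt_integrableD[OF e]] unfolding E_def
  by (rule continuous_on_compose2) auto

section \<open>The double integrals \<open>J\<close> of \<open>e\<close> and \<open>K\<close>
  against a kernel\<close>

definition inner_int :: "(real \<Rightarrow> real \<Rightarrow> complex) \<Rightarrow> real \<Rightarrow> complex" where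
  "inner_int k t = (LINT u|lebesgue. (if t + a < u then K u * k t u else 0))"

text \<open>The integral of \<open>e t * K u * k t u\<close> over the region
  \<open>u > t + a\<close>. Both the \<open>P\<close> term and the quadratic term are brought to
  this form, so that they can be combined at the level of kernels.\<close>

definition J :: "(real \<Rightarrow> real \<Rightarrow> complex) \<Rightarrow> complex" where
  "J k = (LINT t|lebesgue. e t * inner_int k t)"

abbreviation jointly_continuous :: "(real \<Rightarrow> real \<Rightarrow> complex) \<Rightarrow> bool" where
  "jointly_continuous k \<equiv> continuous_on UNIV (\<lambda>p. k (fst p) (snd p))"

text \<open>On the support of \<open>e\<close>, \<open>u > t + a\<close> forces
  \<open>u > 5*a/2\<close>, and \<open>K u = 0\<close> from \<open>3*a\<close> on. The inserted
  indicator is the compactly supported factor that \<open>cpt_Fubini\<close> asks for.\<close>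

lemma inner_int_cutoff:
  "e t * inner_int k t = e t * (LINT u|lebesgue. (if t + a < u then
    (if 5 * a / 2 \<le> u \<and> u \<le> 3 * a then 1 else 0) * (K u * k t u) else 0))"
proof (cases "e t = 0")
  case False
  have "inner_int k t = (LINT u|lebesgue. (if t + a < u then
    (if 5 * a / 2 \<le> u \<and> u \<le> 3 * a then 1 else 0) * (K u * k t u) else 0))"
    unfolding inner_int_def
    by (rule Bochner_Integration.integral_cong) (use esupp[OF False] K_zero in auto)
  then show ?thesis by simp
qed simp

lemma region_borel: "{p. fst p + a < snd p} \<in> sets (borel :: (real \<times> real) measure)"
  by (intro borel_open open_Collect_less continuous_intros)

lemma J_integrable:
  assumes "jointly_continuous k"
  shows "integrable lebesgue (\<lambda>t. e t * inner_int k t)"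
proof -
  have c: "jointly_continuous (\<lambda>t u. K u * k t u)"
    by (intro continuous_intros continuous_K assms)
  show ?thesis
    unfolding inner_int_cutoff by (rule cpt_Fubini(2)[OF e cpt_integrable_Icc region_borel c])
qed

lemma J_diff:
  assumes "jointly_continuous k1" "jointly_continuous k2"
  shows "J (\<lambda>t u. k1 t u - k2 t u) = J k1 - J k2"
proof -
  have i: "integrable lebesgue (\<lambda>u. if t + a < u then K u * k t u else 0)" if k: "jointly_continuous k" for k t
  proof -
    have "continuous_on UNIV (k t)"
      by (rule continuous_on_compose2[OF k, of _ "\<lambda>u. (t, u)", simplified]) (auto intro!: continuous_intros)
    then have "continuous_on UNIV (\<lambda>u. K u * k t u)"
      by (intro continuous_intros continuous_K) auto
    from cpt_integrable_mult[OF cpt_integrable_Icc this]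
    have "cpt_integrable (\<lambda>u. if t + a < u then (if t + a \<le> u \<and> u \<le> 3 * a then 1 else 0) * (K u * k t u) else 0)"
      by (rule cpt_integrable_if) (simp flip: greaterThan_def)
    moreover have "(\<lambda>u. if t + a < u then (if t + a \<le> u \<and> u \<le> 3 * a then 1 else 0) * (K u * k t u) else 0)
        = (\<lambda>u. if t + a < u then K u * k t u else 0)"
      using K_zero by (auto simp: fun_eq_iff)
    ultimately show ?thesis by (simp add: cpt_integrableD)
  qed
  have "inner_int (\<lambda>t u. k1 t u - k2 t u) t = inner_int k1 t - inner_int k2 t" for t
    unfolding inner_int_def Bochner_Integration.integral_diff[OF i[OF assms(1)] i[OF assms(2)], symmetric]
    by (rule Bochner_Integration.integral_cong) (auto simp: algebra_simps)
  then show ?thesis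
    unfolding J_def Bochner_Integration.integral_diff[OF J_integrable[OF assms(1)] J_integrable[OF assms(2)], symmetric]
    by (simp add: right_diff_distrib)
qed

text \<open>When the kernel is free of \<open>t\<close>, exchanging the order leaves
  \<open>e\<close> to be integrated alone over \<open>t < u - a\<close>, which is
  \<open>E (u - a)\<close>.\<close>

lemma J_right:
  assumes "continuous_on UNIV \<phi>"
  shows "J (\<lambda>t u. \<phi> u) = (LINT u|lebesgue. K u * E (u - a) * \<phi> u)"
proof -
  let ?I = "\<lambda>u. if 5 * a / 2 \<le> u \<and> u \<le> 3 * a then 1 else 0 :: complex"
  have c: "jointly_continuous (\<lambda>t u. K u * \<phi> u)"
    by (intro continuous_intros continuous_K continuous_on_compose2[OF assms]) auto
  have "J (\<lambda>t u. \<phi> u) = (LINT t|lebesgue. e t * (LINT u|lebesgue. (if t + a < u then ?I u * (K u * \<phi> u) else 0)))"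
    unfolding J_def inner_int_cutoff ..
  also have "\<dots> = (LINT u|lebesgue. ?I u * (LINT t|lebesgue. (if t + a < u then e t * (K u * \<phi> u) else 0)))"
    by (rule cpt_Fubini(1)[OF e cpt_integrable_Icc region_borel c])
  also have "\<dots> = (LINT u|lebesgue. K u * E (u - a) * \<phi> u)"
  proof (rule Bochner_Integration.integral_cong[OF refl])
    fix u
    have "(\<lambda>t. if t + a < u then e t * (K u * \<phi> u) else 0) = (\<lambda>t. (K u * \<phi> u) * (if t < u - a then e t else 0))"
      by auto
    then have "(LINT t|lebesgue. (if t + a < u then e t * (K u * \<phi> u) else 0)) = (K u * \<phi> u) * E (u - a)"
      by (simp add: E_def)
    then show "?I u * (LINT t|lebesgue. (if t + a < u then e t * (K u * \<phi> u) else 0)) = K u * E (u - a) * \<phi> u"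
      using K_zero[of u] E_zero[of "u - a"] by auto
  qed
  finally show ?thesis .
qed

text \<open>Here the eigenvalue equation enters, through the substitution \<open>u = v + t - a/2\<close>.\<close>

lemma J_convolution:
  assumes \<psi>: "continuous_on UNIV \<psi>"
  shows "J (\<lambda>t u. \<psi> (u - t)) = (LINT v|lebesgue. e v * \<psi> (v - a / 2))"
proof -
  let ?I = "\<lambda>v. if 3 * a / 2 \<le> v \<and> v \<le> 2 * a then 1 else 0 :: complex"
  let ?k = "\<lambda>t v. K (v + t - a / 2) * \<psi> (v - a / 2)"
  have c: "jointly_continuous ?k"
    by (intro continuous_intros continuous_K continuous_on_compose2[OF \<psi>]) auto
  have c': "jointly_continuous (\<lambda>v t. ?k t v)"
    by (intro continuous_intros continuous_K continuous_on_compose2[OF \<psi>]) auto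
  have P: "{p. 3 * a / 2 < snd p} \<in> sets (borel :: (real \<times> real) measure)"
    "{p. 3 * a / 2 < fst p} \<in> sets (borel :: (real \<times> real) measure)"
    by (intro borel_open open_Collect_less continuous_intros)+
  have inner: "e t * inner_int (\<lambda>t u. \<psi> (u - t)) t
      = e t * (LINT v|lebesgue. (if 3 * a / 2 < v then ?I v * ?k t v else 0))" for t
  proof (cases "e t = 0")
    case False
    have [measurable]: "(\<lambda>u. K u * \<psi> (u - t)) \<in> borel_measurable borel"
      by (intro borel_measurable_continuous_onI continuous_intros continuous_K continuous_on_compose2[OF \<psi>]) auto
    have "inner_int (\<lambda>t u. \<psi> (u - t)) t = (LINT v|lebesgue.
       (if t + a < v + (t - a / 2) then K (v + (t - a / 2)) * \<psi> (v + (t - a / 2) - t) else 0))"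
      unfolding inner_int_def by (rule lebesgue_integral_shift) measurable
    also have "\<dots> = (LINT v|lebesgue. (if 3 * a / 2 < v then ?I v * ?k t v else 0))"
    proof (rule Bochner_Integration.integral_cong[OF refl])
      fix v
      have eqs: "t + a < v + (t - a / 2) \<longleftrightarrow> 3 * a / 2 < v" "v + (t - a / 2) - t = v - a / 2" "v + (t - a / 2) = v + t - a / 2"
        by auto
      \<comment> \<open>On the support of \<open>e\<close>, \<open>v > 2*a\<close> gives
        \<open>v + t - a/2 > 3*a\<close>, where \<open>K\<close> vanishes; so inserting
        \<open>?I v\<close> changes nothing.\<close>
      show "(if t + a < v + (t - a / 2) then K (v + (t - a / 2)) * \<psi> (v + (t - a / 2) - t) else 0)
          = (if 3 * a / 2 < v then ?I v * ?k t v else 0)"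
        unfolding eqs using K_zero[of "v + t - a / 2"] esupp[OF False] by auto
    qed
    finally show ?thesis by simp
  qed simp
  have "J (\<lambda>t u. \<psi> (u - t)) = (LINT t|lebesgue. e t * (LINT v|lebesgue. (if 3 * a / 2 < v then ?I v * ?k t v else 0)))"
    unfolding J_def inner ..
  also have "\<dots> = (LINT v|lebesgue. ?I v * (LINT t|lebesgue. (if 3 * a / 2 < v then e t * ?k t v else 0)))"
    by (rule cpt_Fubini(1)[OF e cpt_integrable_Icc P(1) c])
  also have "\<dots> = (LINT v|lebesgue. e v * \<psi> (v - a / 2))"
  proof (rule integral_cong_AE)
    \<comment> \<open>Measurability in \<open>v\<close> comes from Fubini with the roles of the two
      variables exchanged, hence the second region and \<open>c'\<close>.\<close>
    show "(\<lambda>v. ?I v * (LINT t|lebesgue. (if 3 * a / 2 < v then e t * ?k t v else 0))) \<in> borel_measurable lebesgue"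
      by (rule borel_measurable_integrable, rule cpt_Fubini(2)[OF cpt_integrable_Icc e P(2) c'])
    have "cpt_integrable (\<lambda>v. e v * \<psi> (v - a / 2))"
      by (intro cpt_integrable_mult e continuous_on_compose2[OF \<psi>] continuous_intros) auto
    then show "(\<lambda>v. e v * \<psi> (v - a / 2)) \<in> borel_measurable lebesgue"
      by (intro borel_measurable_integrable cpt_integrableD)
    show "AE v in lebesgue. ?I v * (LINT t|lebesgue. (if 3 * a / 2 < v then e t * ?k t v else 0)) = e v * \<psi> (v - a / 2)"
      using eigen AE_lebesgue_neq[of "2 * a"] AE_lebesgue_neq[of "3 * a / 2"]
    proof eventually_elim
      case (elim v)
      show ?case
      proof (cases "3 * a / 2 < v \<and> v < 2 * a")
        case True
        \<comment> \<open>With the \<open>\<psi>\<close> factor taken out, the remaining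
          \<open>t\<close>-integral is the left side of the eigenvalue equation at
          \<open>v\<close>.\<close>
        have "(\<lambda>t. e t * ?k t v) = (\<lambda>t. \<psi> (v - a / 2) * (K (v + t - a / 2) * e t))" by auto
        then have "(LINT t|lebesgue. e t * ?k t v) = \<psi> (v - a / 2) * e v"
          using elim True by (simp add: K_def)
        then show ?thesis using True by simp
      next
        case False
        then show ?thesis using elim esupp[of v] by auto
      qed
    qed
  qed
  finally show ?thesis .
qed

text \<open>The product \<open>sn l (x - u) * sn l (u - b)\<close> has \<open>u\<close>-derivative
  \<open>sn l (x - 2*u + b)\<close> and vanishes at \<open>u = b\<close>, so its value at
  \<open>u = t\<close> is an integral over \<open>(b, t)\<close>. Exchanging the order replaces
  \<open>H\<close> by its tail integral \<open>K\<close>: an integration by parts for integrable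
  \<open>H\<close>.\<close>

lemma tail_product_integral:
  assumes "b \<le> 3 * a"
  shows "(LINT t|lebesgue. (if b < t then H t * (sn l (x - t) * sn l (t - b)) else 0))
       = (LINT u|lebesgue. (if b < u then K u * sn l (x - 2 * u + b) else 0))"
proof -
  let ?I = "\<lambda>u. if b \<le> u \<and> u \<le> 3 * a then 1 else 0 :: complex"
  have c: "jointly_continuous (\<lambda>t u. sn l (x - 2 * u + b))"
    by (intro continuous_on_sn continuous_intros)
  have P: "{p. b < snd p \<and> snd p < fst p} \<in> sets (borel :: (real \<times> real) measure)"
    by (intro borel_open open_Collect_conj open_Collect_less continuous_intros)
  have "(if b < t then H t * (sn l (x - t) * sn l (t - b)) else 0)
      = H t * (LINT u|lebesgue. (if b < u \<and> u < t then ?I u * sn l (x - 2 * u + b) else 0))" for t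
  proof (cases "H t \<noteq> 0 \<and> b < t")
    case True
    then have t: "t < 3 * a" "b < t" using Hsupp by auto
    have "(LINT u|lebesgue. (if b < u \<and> u < t then ?I u * sn l (x - 2 * u + b) else 0))
        = (LINT u|lebesgue. (if b < u \<and> u < t then sn l (x - 2 * u + b) else 0))"
      using t by (intro Bochner_Integration.integral_cong) auto
    also have "\<dots> = sn l (x - t) * sn l (t - b) - sn l (x - b) * sn l (b - b)"
    proof (rule FTC_lebesgue(2)[where F = "\<lambda>u. sn l (x - u) * sn l (u - b)"])
      show "((\<lambda>u. sn l (x - u) * sn l (u - b)) has_vector_derivative sn l (x - 2 * u + b)) (at u)" for u
      proof -
        have 1: "((\<lambda>u. x - u) has_vector_derivative - 1) (at u)" and 2: "((\<lambda>u. u - b) has_vector_derivative 1) (at u)"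
          by (auto intro!: derivative_eq_intros)
        have 3: "((\<lambda>u. sn l (x - u)) has_vector_derivative - cs l (x - u)) (at u)"
          using vector_diff_chain_at[OF 1 sn_has_vector_derivative, of l] by (simp add: o_def)
        have 4: "((\<lambda>u. sn l (u - b)) has_vector_derivative cs l (u - b)) (at u)"
          using vector_diff_chain_at[OF 2 sn_has_vector_derivative, of l] by (simp add: o_def)
        show ?thesis
        proof (rule has_vector_derivative_eq_rhs[OF has_vector_derivative_mult[OF 3 4]])
          show "sn l (x - u) * cs l (u - b) + - cs l (x - u) * sn l (u - b) = sn l (x - 2 * u + b)"
            using sn_diff[of l "x - u" "u - b"] by (simp add: algebra_simps)
        qed
      qed
      show "continuous_on UNIV (\<lambda>u. sn l (x - 2 * u + b))"
        by (intro continuous_on_sn continuous_intros)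
    qed (use t in auto)
    finally show ?thesis using t by simp
  next
    case False
    moreover have "(\<lambda>u. if b < u \<and> u < t then ?I u * sn l (x - 2 * u + b) else 0) = (\<lambda>u. 0)" if "\<not> b < t"
      using that by (auto simp: fun_eq_iff)
    ultimately show ?thesis by auto
  qed
  then have "(LINT t|lebesgue. (if b < t then H t * (sn l (x - t) * sn l (t - b)) else 0))
      = (LINT t|lebesgue. H t * (LINT u|lebesgue. (if b < u \<and> u < t then ?I u * sn l (x - 2 * u + b) else 0)))"
    by simp
  also have "\<dots> = (LINT u|lebesgue. ?I u * (LINT t|lebesgue. (if b < u \<and> u < t then H t * sn l (x - 2 * u + b) else 0)))"
    by (rule cpt_Fubini(1)[OF H cpt_integrable_Icc P c])
  also have "\<dots> = (LINT u|lebesgue. (if b < u then K u * sn l (x - 2 * u + b) else 0))"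
  proof (rule Bochner_Integration.integral_cong[OF refl])
    fix u
    have "(\<lambda>t. if u < t then H t * sn l (x - 2 * u + b) else 0) = (\<lambda>t. sn l (x - 2 * u + b) * (if u < t then H t else 0))"
      by auto
    then have "(LINT t|lebesgue. (if u < t then H t * sn l (x - 2 * u + b) else 0)) = sn l (x - 2 * u + b) * K u"
      by (simp add: K_def)
    then show "?I u * (LINT t|lebesgue. (if b < u \<and> u < t then H t * sn l (x - 2 * u + b) else 0))
        = (if b < u then K u * sn l (x - 2 * u + b) else 0)"
      using K_zero[of u] by auto
  qed
  finally show ?thesis .
qed

text \<open>Up to the factor \<open>-\<alpha>\<close>, the branch of the potential on
  \<open>(2*a, 5*a/2)\<close>. The cutoff is built in: the factor \<open>E\<close> vanishes for
  \<open>t \<le> 2*a\<close>, the factor \<open>K\<close> for \<open>t \<ge> 5*a/2\<close>.\<close>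

definition P :: "real \<Rightarrow> complex" where
  "P t = K (t + a / 2) * E (t - a / 2)"

lemma P_supp: "P t \<noteq> 0 \<Longrightarrow> 2 * a < t \<and> t < 5 * a / 2"
  using K_zero[of "t + a / 2"] E_zero[of "t - a / 2"] by (force simp: P_def)

lemma P_cpt_integrable: "cpt_integrable P"
proof -
  have "continuous_on UNIV P"
    unfolding P_def by (intro continuous_intros continuous_K continuous_E)
  from cpt_integrable_mult[OF cpt_integrable_Icc[of "2 * a" "5 * a / 2"] this]
  have "cpt_integrable (\<lambda>t. (if 2 * a \<le> t \<and> t \<le> 5 * a / 2 then 1 else 0) * P t)" .
  moreover have "(\<lambda>t. (if 2 * a \<le> t \<and> t \<le> 5 * a / 2 then 1 else 0) * P t) = P"
    using P_supp by force
  ultimately show ?thesis by simp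
qed

section \<open>The coefficient of \<alpha> and its vanishing\<close>

lemma sn_prod: "sn l (t - a) * sn l (x - t) = ps l (x - 2 * t + a) - ps l (x - a)"
  using sn_mult[of l "x - t" "t - a"] by (simp add: algebra_simps)

text \<open>Apply \<open>J_right\<close> and substitute \<open>u = t + a/2\<close>: then
  \<open>K u * E (u - a)\<close> becomes \<open>P t\<close>, and the kernel becomes the product in
  \<open>sn_prod\<close>.\<close>

lemma linear_part_P:
  "(LINT t|lebesgue. P t * (sn l (t - a) * sn l (x - t))) = J (\<lambda>t u. ps l (x - 2 * u + 2 * a) - ps l (x - a))"
proof -
  have c: "continuous_on UNIV (\<lambda>u. ps l (x - 2 * u + 2 * a) - ps l (x - a))"
    by (intro continuous_intros continuous_on_ps)
  have [measurable]: "(\<lambda>u. K u * E (u - a) * (ps l (x - 2 * u + 2 * a) - ps l (x - a))) \<in> borel_measurable borel"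
    by (intro borel_measurable_continuous_onI continuous_intros continuous_K continuous_E continuous_on_ps)
  have "J (\<lambda>t u. ps l (x - 2 * u + 2 * a) - ps l (x - a))
     = (LINT u|lebesgue. K u * E (u - a) * (ps l (x - 2 * u + 2 * a) - ps l (x - a)))"
    by (rule J_right[OF c])
  also have "\<dots> = (LINT t|lebesgue. K (t + a / 2) * E (t + a / 2 - a) * (ps l (x - 2 * (t + a / 2) + 2 * a) - ps l (x - a)))"
    by (rule lebesgue_integral_shift) measurable
  also have "\<dots> = (LINT t|lebesgue. P t * (sn l (t - a) * sn l (x - t)))"
    by (rule Bochner_Integration.integral_cong) (simp_all add: P_def sn_prod algebra_simps)
  finally show ?thesis by simp
qed

text \<open>With the integration over the support of \<open>e\<close> put outermost, the inner
  integral is \<open>tail_product_integral\<close> for \<open>b = s + a\<close>. Multiplying by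
  \<open>sn l (s - a)\<close> and applying \<open>sn_mult\<close> gives the arguments
  \<open>x - 2*u + 2*a\<close> and \<open>x - 2*(u - s)\<close>.\<close>

lemma quadratic_part:
  "(LINT t|lebesgue. H t * sn l (x - t) * conv (\<lambda>s. e s * sn l (s - a)) (sn l) (t - a))
    = J (\<lambda>t u. ps l (x - 2 * u + 2 * a) - ps l (x - 2 * (u - t)))"
proof -
  have c: "jointly_continuous (\<lambda>s t. sn l (t - a - s))"
    by (intro continuous_on_sn continuous_intros)
  have f: "cpt_integrable (\<lambda>s. e s * sn l (s - a))"
    by (intro cpt_integrable_mult e continuous_on_sn continuous_intros)
  have g: "cpt_integrable (\<lambda>t. H t * sn l (x - t))"
    by (intro cpt_integrable_mult H continuous_on_sn continuous_intros)
  have "(LINT t|lebesgue. H t * sn l (x - t) * conv (\<lambda>s. e s * sn l (s - a)) (sn l) (t - a))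
     = (LINT t|lebesgue. H t * sn l (x - t) * (LINT s|lebesgue. (if s + a < t then e s * sn l (s - a) * sn l (t - a - s) else 0)))"
    unfolding conv_def by (simp add: less_diff_eq)
  also have "\<dots> = (LINT s|lebesgue. e s * sn l (s - a) * (LINT t|lebesgue. (if s + a < t then H t * sn l (x - t) * sn l (t - a - s) else 0)))"
    by (rule cpt_Fubini(1)[OF f g region_borel c, symmetric])
  also have "\<dots> = J (\<lambda>t u. ps l (x - 2 * u + 2 * a) - ps l (x - 2 * (u - t)))"
    unfolding J_def
  proof (rule Bochner_Integration.integral_cong[OF refl])
    fix s
    show "e s * sn l (s - a) * (LINT t|lebesgue. (if s + a < t then H t * sn l (x - t) * sn l (t - a - s) else 0))
        = e s * inner_int (\<lambda>t u. ps l (x - 2 * u + 2 * a) - ps l (x - 2 * (u - t))) s"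
    proof (cases "e s = 0")
      case False
      then have "s + a \<le> 3 * a" using esupp by force
      note tail = tail_product_integral[OF this, of l x]
      have "H t * sn l (x - t) * sn l (t - a - s) = H t * (sn l (x - t) * sn l (t - (s + a)))" for t
        by (simp add: mult.assoc diff_diff_eq add.commute)
      with tail have "(LINT t|lebesgue. (if s + a < t then H t * sn l (x - t) * sn l (t - a - s) else 0))
          = (LINT u|lebesgue. (if s + a < u then K u * sn l (x - 2 * u + (s + a)) else 0))"
        by (simp only:)
      then have "sn l (s - a) * (LINT t|lebesgue. (if s + a < t then H t * sn l (x - t) * sn l (t - a - s) else 0))
          = (LINT u|lebesgue. sn l (s - a) * (if s + a < u then K u * sn l (x - 2 * u + (s + a)) else 0))"
        by simp
      also have "\<dots> = inner_int (\<lambda>t u. ps l (x - 2 * u + 2 * a) - ps l (x - 2 * (u - t))) s"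
        unfolding inner_int_def
      proof (rule Bochner_Integration.integral_cong[OF refl])
        fix u
        have "sn l (x - 2 * u + (s + a)) * sn l (s - a) = ps l (x - 2 * u + 2 * a) - ps l (x - 2 * (u - s))"
          using sn_mult[of l "x - 2 * u + (s + a)" "s - a"] by (simp add: algebra_simps)
        then show "sn l (s - a) * (if s + a < u then K u * sn l (x - 2 * u + (s + a)) else 0)
          = (if s + a < u then K u * (ps l (x - 2 * u + 2 * a) - ps l (x - 2 * (u - s))) else 0)"
          by (simp add: mult_ac)
      qed
      finally show ?thesis by (simp add: mult.assoc)
    qed simp
  qed
  finally show ?thesis .
qed

text \<open>Subtracting the two \<open>J\<close> kernels cancels
  \<open>ps l (x - 2*u + 2*a)\<close>. What remains depends on \<open>u - t\<close> only, so
  \<open>J_convolution\<close> turns it into a single integral against \<open>e\<close>, the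
  negative of the first term. The sum is the coefficient of \<open>\<alpha>\<close> in
  \<open>picard2\<close> for \<open>x \<ge> 3*a\<close>.\<close>

lemma linear_part_vanishes:
  "(LINT t|lebesgue. e t * (sn l (t - a) * sn l (x - t))) - (LINT t|lebesgue. P t * (sn l (t - a) * sn l (x - t)))
    + (LINT t|lebesgue. H t * sn l (x - t) * conv (\<lambda>s. e s * sn l (s - a)) (sn l) (t - a)) = 0"
proof -
  have c: "jointly_continuous (\<lambda>t u. ps l (x - 2 * u + 2 * a) - ps l (x - 2 * (u - t)))"
    "jointly_continuous (\<lambda>t u. ps l (x - 2 * u + 2 * a) - ps l (x - a))"
    by (intro continuous_intros continuous_on_ps)+
  have c': "continuous_on UNIV (\<lambda>w. ps l (x - a) - ps l (x - 2 * w))"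
    by (intro continuous_intros continuous_on_ps)
  have "J (\<lambda>t u. ps l (x - 2 * u + 2 * a) - ps l (x - 2 * (u - t))) - J (\<lambda>t u. ps l (x - 2 * u + 2 * a) - ps l (x - a))
      = J (\<lambda>t u. ps l (x - a) - ps l (x - 2 * (u - t)))"
    unfolding J_diff[OF c, symmetric] by simp
  also have "\<dots> = (LINT v|lebesgue. e v * (ps l (x - a) - ps l (x - 2 * (v - a / 2))))"
    by (rule J_convolution[OF c'])
  \<comment> \<open>Here \<open>x - 2*(v - a/2) = x - 2*v + a\<close>, so \<open>sn_prod\<close>
    applies with reversed sign.\<close>
  also have "\<dots> = (LINT v|lebesgue. - (e v * (sn l (v - a) * sn l (x - v))))"
    by (rule Bochner_Integration.integral_cong) (simp_all add: sn_prod algebra_simps)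
  also have "\<dots> = - (LINT v|lebesgue. e v * (sn l (v - a) * sn l (x - v)))"
    by simp
  finally show ?thesis unfolding linear_part_P quadratic_part by (simp add: algebra_simps)
qed

section \<open>The potential and its second Picard iterate to the right of the support\<close>

definition q :: "complex \<Rightarrow> real \<Rightarrow> complex" where
  "q \<alpha> t = \<alpha> * e t - \<alpha> * P t + H t"

lemma q_cpt_integrable: "cpt_integrable (q \<alpha>)"
  unfolding q_def[abs_def] diff_conv_add_uminus minus_mult_left
  by (intro cpt_integrable_add cpt_integrable_cmult e H P_cpt_integrable)

lemma q_supp: "q \<alpha> t \<noteq> 0 \<Longrightarrow> 3 * a / 2 < t \<and> t < 3 * a"
  using esupp[of t] Hsupp[of t] P_supp[of t] a unfolding q_def by (cases "e t = 0"; cases "H t = 0"; cases "P t = 0") auto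

text \<open>A contribution pairs \<open>t\<close> with some \<open>s < t - a\<close>, both in the
  support of \<open>q \<alpha>\<close>. This forces \<open>t\<close> into the range of
  \<open>H\<close> and \<open>s\<close> into that of \<open>e\<close>, so only one factor
  \<open>\<alpha>\<close> occurs.\<close>

lemma q_conv: "q \<alpha> t * conv (\<lambda>s. q \<alpha> s * sn l (s - a)) (sn l) (t - a)
    = \<alpha> * (H t * conv (\<lambda>s. e s * sn l (s - a)) (sn l) (t - a))"
proof (cases "5 * a / 2 < t \<and> t < 3 * a")
  case True
  then have "e t = 0" "P t = 0" using esupp[of t] P_supp[of t] a by force+
  then have 1: "q \<alpha> t = H t" by (simp add: q_def)
  have "q \<alpha> s = \<alpha> * e s" if "s < t - a" for s
    using Hsupp[of s] P_supp[of s] True a that by (force simp: q_def)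
  then have "conv (\<lambda>s. q \<alpha> s * sn l (s - a)) (sn l) (t - a) = conv (\<lambda>s. \<alpha> * (e s * sn l (s - a))) (sn l) (t - a)"
    by (intro conv_cong) simp
  also have "\<dots> = (LINT s|lebesgue. \<alpha> * (if s < t - a then e s * sn l (s - a) * sn l (t - a - s) else 0))"
    unfolding conv_def by (intro Bochner_Integration.integral_cong) auto
  also have "\<dots> = \<alpha> * conv (\<lambda>s. e s * sn l (s - a)) (sn l) (t - a)"
    by (simp add: conv_def)
  finally show ?thesis unfolding 1 by (simp add: mult_ac)
next
  case False
  \<comment> \<open>Then \<open>s < t - a \<le> 3*a/2\<close> lies to the left of the
    support.\<close>
  have "conv (\<lambda>s. q \<alpha> s * sn l (s - a)) (sn l) (t - a) = 0" if "t \<le> 5 * a / 2"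
  proof -
    have "q \<alpha> s = 0" if "s < t - a" for s
      using q_supp[of \<alpha> s] \<open>t \<le> 5 * a / 2\<close> that by force
    then have "conv (\<lambda>s. q \<alpha> s * sn l (s - a)) (sn l) (t - a) = conv (\<lambda>s. 0) (sn l) (t - a)"
      by (intro conv_cong) simp
    then show ?thesis by (simp add: conv_def cong: if_cong)
  qed
  then show ?thesis using False Hsupp[of t] q_supp[of \<alpha> t] by force
qed

text \<open>For \<open>x \<ge> 3*a\<close> the whole support lies to the left of \<open>x\<close>,
  so the truncation at \<open>x\<close> disappears. Sorting by powers of \<open>\<alpha>\<close>,
  the linear coefficient is the expression in \<open>linear_part_vanishes\<close>.\<close>

lemma picard2_q:
  assumes "3 * a \<le> x"
  shows "picard2 a (q \<alpha>) l x = sn l x + (LINT t|lebesgue. H t * (sn l (t - a) * sn l (x - t)))"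
proof -
  let ?s = "\<lambda>t. sn l (t - a) * sn l (x - t)"
  let ?c = "\<lambda>t. conv (\<lambda>s. e s * sn l (s - a)) (sn l) (t - a)"
  have cs: "continuous_on UNIV ?s"
    by (intro continuous_intros continuous_on_sn)
  have "cpt_integrable (\<lambda>s. e s * sn l (s - a))"
    by (intro cpt_integrable_mult e continuous_on_sn continuous_intros)
  from conv_trig_continuous(1)[OF this, of l] have "continuous_on UNIV ?c"
    by (rule continuous_on_compose2) (auto intro!: continuous_intros)
  then have cc: "continuous_on UNIV (\<lambda>t. sn l (x - t) * ?c t)"
    by (intro continuous_intros continuous_on_sn)
  have i: "integrable lebesgue (\<lambda>t. e t * ?s t)" "integrable lebesgue (\<lambda>t. P t * ?s t)"
    "integrable lebesgue (\<lambda>t. H t * ?s t)"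
    by (rule cpt_integrableD, rule cpt_integrable_mult[OF _ cs], rule e P_cpt_integrable H)+
  have i': "integrable lebesgue (\<lambda>t. H t * sn l (x - t) * ?c t)"
    using cpt_integrableD[OF cpt_integrable_mult[OF H cc]] by (simp add: mult.assoc)
  have "conv (\<lambda>t. q \<alpha> t * picard1 a (q \<alpha>) l (t - a)) (sn l) x
      = (LINT t|lebesgue. (\<alpha> * (e t * ?s t) - \<alpha> * (P t * ?s t) + H t * ?s t) + \<alpha> * (H t * sn l (x - t) * ?c t))"
    unfolding conv_def[of _ _ x]
  proof (rule Bochner_Integration.integral_cong[OF refl])
    fix t
    have "(if t < x then q \<alpha> t * picard1 a (q \<alpha>) l (t - a) * sn l (x - t) else 0)
        = q \<alpha> t * picard1 a (q \<alpha>) l (t - a) * sn l (x - t)"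
      using q_supp[of \<alpha> t] assms by auto
    also have "\<dots> = q \<alpha> t * ?s t + q \<alpha> t * conv (\<lambda>s. q \<alpha> s * sn l (s - a)) (sn l) (t - a) * sn l (x - t)"
      by (simp add: picard1_def algebra_simps)
    finally show "(if t < x then q \<alpha> t * picard1 a (q \<alpha>) l (t - a) * sn l (x - t) else 0)
        = (\<alpha> * (e t * ?s t) - \<alpha> * (P t * ?s t) + H t * ?s t) + \<alpha> * (H t * sn l (x - t) * ?c t)"
      unfolding q_conv by (simp add: q_def algebra_simps)
  qed
  also have "\<dots> = (LINT t|lebesgue. H t * ?s t) + \<alpha> * ((LINT t|lebesgue. e t * ?s t) - (LINT t|lebesgue. P t * ?s t)
      + (LINT t|lebesgue. H t * sn l (x - t) * ?c t))"
    using i i' by (simp add: algebra_simps)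
  finally show ?thesis
    unfolding picard2_def linear_part_vanishes by simp
qed

end

section \<open>Transfer to the given data\<close>

lemma L2_on_bounded_integrable:
  fixes f :: "real \<Rightarrow> complex"
  assumes "L2_on {A<..<B} f"
  shows "cpt_integrable (\<lambda>x. if x \<in> {A<..<B} then f x else 0)"
proof -
  have "emeasure (lebesgue_on {A<..<B}) (space (lebesgue_on {A<..<B})) < \<infinity>"
    by (cases "A \<le> B") (auto simp: emeasure_restrict_space space_restrict_space)
  then have "integrable (lebesgue_on {A<..<B}) (\<lambda>x. 1 + (norm (f x))\<^sup>2)"
    using assms by (intro Bochner_Integration.integrable_add) (auto simp: L2_on_def finite_measure.integrable_const finite_measureI)
  then have "integrable (lebesgue_on {A<..<B}) f"
  proof (rule Bochner_Integration.integrable_bound)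
    have "norm (f x) \<le> norm (1 + (norm (f x))\<^sup>2)" for x
    proof -
      \<comment> \<open>Square-integrability gives integrability on a bounded interval, since
        \<open>(norm (f x) - 1)^2 \<ge> 0\<close>.\<close>
      have "2 * norm (f x) \<le> 1 + (norm (f x))\<^sup>2"
        using zero_le_power2[of "norm (f x) - 1"] by (simp add: power2_diff)
      moreover have "norm (1 + (norm (f x))\<^sup>2) = 1 + (norm (f x))\<^sup>2" by simp
      ultimately show ?thesis using norm_ge_zero[of "f x"] by linarith
    qed
    then show "AE x in lebesgue_on {A<..<B}. norm (f x) \<le> norm (1 + (norm (f x))\<^sup>2)" by simp
  qed (use assms in \<open>simp add: L2_on_def\<close>)
  then have "integrable lebesgue (\<lambda>x. if x \<in> {A<..<B} then f x else 0)"
    by (intro Lebesgue_Measure.integrable_restrict_UNIV[THEN iffD2]) auto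
  then show ?thesis
    by (rule cpt_integrableI[where A = "max \<bar>A\<bar> \<bar>B\<bar>"]) (auto split: if_splits)
qed

text \<open>The zero extensions of \<open>e0\<close> and \<open>h0\<close> form an
  \<open>eigenpair\<close> whose \<open>q\<close> is exactly \<open>q_fam\<close>. As
  \<open>a < pi/3\<close>, the point \<open>3*a\<close> lies below \<open>pi\<close>, and
  \<open>char_fun_eqI\<close> applies with \<open>c = 3*a\<close>.\<close>

lemma char_fun_q_fam:
  fixes h0 e0 :: "real \<Rightarrow> complex"
  assumes a: "0 < a" "a < pi / 3"
    and h0: "L2_on {5*a/2<..<3*a} h0"
    and M: "M_eigenfunction a h0 1 e0"
    and j: "j \<in> {0, 1}"
  shows "char_fun j a (q_fam a h0 e0 \<alpha>) l = char_fun j a (q_fam a h0 e0 \<beta>) l"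
proof -
  define e where "e = (\<lambda>x. if x \<in> {3*a/2<..<2*a} then e0 x else 0)"
  define H where "H = (\<lambda>x. if x \<in> {5*a/2<..<3*a} then h0 x else 0)"
  \<comment> \<open>For smaller \<open>x\<close>, \<open>K_ker\<close> would see values of
    \<open>h0\<close> outside \<open>(5*a/2, 3*a)\<close>, on which nothing is assumed.\<close>
  have K: "K_ker a h0 x = (LINT s|lebesgue. (if x < s then H s else 0))" if "5 * a / 2 \<le> x" for x
    unfolding K_ker_def using that
    by (subst LINT_lebesgue_on) (auto simp: H_def intro!: Bochner_Integration.integral_cong)
  have "AE v in lebesgue. v \<in> {3*a/2<..<2*a} \<longrightarrow> M_op a h0 e0 v = e0 v"
    using M unfolding M_eigenfunction_def by (simp add: AE_restrict_space_iff)
  then have eig: "AE v in lebesgue. 3 * a / 2 < v \<and> v < 2 * a \<longrightarrow>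
        (LINT t|lebesgue. (LINT s|lebesgue. (if v + t - a / 2 < s then H s else 0)) * e t) = e v"
  proof eventually_elim
    case (elim v)
    show ?case
    proof
      assume v: "3 * a / 2 < v \<and> v < 2 * a"
      have "M_op a h0 e0 v = (LINT t|lebesgue. (LINT s|lebesgue. (if v + t - a / 2 < s then H s else 0)) * e t)"
        unfolding M_op_def
      proof (subst LINT_lebesgue_on, simp, rule Bochner_Integration.integral_cong[OF refl])
        fix t
        have 0: "(LINT s|lebesgue. (if v + t - a / 2 < s then H s else 0)) = 0" if "7 * a / 2 - v \<le> t"
        proof -
          have "(\<lambda>s. if v + t - a / 2 < s then H s else 0) = (\<lambda>s. 0)"
            using that by (auto simp: H_def fun_eq_iff)
          then show ?thesis by simp
        qed
        show "(if t \<in> {3*a/2<..<7*a/2 - v} then K_ker a h0 (v + t - a / 2) * e0 t else 0)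
          = (LINT s|lebesgue. (if v + t - a / 2 < s then H s else 0)) * e t"
        proof (cases "t \<in> {3*a/2<..<7*a/2 - v}")
          case True
          \<comment> \<open>As \<open>v > 3*a/2\<close>, the upper limit \<open>7*a/2 - v\<close> is
            below \<open>2*a\<close>; as also \<open>t > 3*a/2\<close>, the argument of the kernel
            exceeds \<open>5*a/2\<close>.\<close>
          then have "e t = e0 t" "5 * a / 2 \<le> v + t - a / 2" using v by (auto simp: e_def)
          with K True show ?thesis by simp
        next
          case False
          then have "e t = 0 \<or> 7 * a / 2 - v \<le> t" by (auto simp: e_def)
          with False 0 show ?thesis by auto
        qed
      qed
      with elim v show "(LINT t|lebesgue. (LINT s|lebesgue. (if v + t - a / 2 < s then H s else 0)) * e t) = e v"
        by (simp add: e_def)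
    qed
  qed
  interpret eigenpair a e H
  proof
    show "cpt_integrable e"
      unfolding e_def using M by (intro L2_on_bounded_integrable) (simp add: M_eigenfunction_def)
    show "cpt_integrable H"
      unfolding H_def using h0 by (rule L2_on_bounded_integrable)
  qed (use a eig in \<open>auto simp: e_def H_def split: if_splits\<close>)
  \<comment> \<open>The bound on \<open>x\<close> keeps \<open>x - a/2\<close> below
    \<open>2*a\<close>, so \<open>e\<close> and \<open>e0\<close> agree on the range of
    integration.\<close>
  have E0: "(LINT t|lebesgue_on {3*a/2<..<x - a/2}. e0 t) = E (x - a / 2)" if "x < 5 * a / 2" for x
    unfolding E_def using that
    by (subst LINT_lebesgue_on) (auto simp: e_def intro!: Bochner_Integration.integral_cong)
  have "q_fam a h0 e0 \<gamma> x = q \<gamma> x" for \<gamma> x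
  proof (cases "2 * a < x \<and> x < 5 * a / 2")
    case True
    then have "e x = 0" "H x = 0"
      by (auto simp: e_def H_def)
    moreover have "K_ker a h0 (x + a / 2) = K (x + a / 2)"
      unfolding K_def using True by (intro K) simp
    ultimately show ?thesis using True E0[of x] by (simp add: q_fam_def q_def P_def)
  next
    case False
    then have "P x = 0" using P_supp by blast
    then have q: "q \<gamma> x = \<gamma> * e x + H x" by (simp add: q_def)
    have eH: "e x = (if 3*a/2 < x \<and> x < 2*a then e0 x else 0)" "H x = (if 5*a/2 < x \<and> x < 3*a then h0 x else 0)"
      by (simp_all add: e_def H_def)
    show ?thesis unfolding q q_fam_def eH using False a by auto
  qed
  then have q: "q_fam a h0 e0 \<gamma> = q \<gamma>" for \<gamma> by auto
  show ?thesis unfolding q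
  proof (rule char_fun_eqI[OF assms(1) _ q_cpt_integrable q_supp q_cpt_integrable q_supp _ j, where c = "3 * a"])
    show "3 * a < pi" using assms(2) by simp
    show "picard2 a (q \<alpha>) l x = picard2 a (q \<beta>) l x" if "3 * a \<le> x" for x
      using that by (simp add: picard2_q)
  qed
qed

theorem theorem1:
  fixes a :: real and h :: "real \<Rightarrow> real" and \<eta> :: complex
    and h0 e0 :: "real \<Rightarrow> complex" and j :: nat
  assumes "0 < a" and "a < pi / 3"
    and "L2_on {5*a/2<..<3*a} h" and "nonzero_on {5*a/2<..<3*a} h"
    and "\<eta> \<noteq> 0" and "M_eigenvalue a (\<lambda>x. complex_of_real (h x)) \<eta>"
    and "h0 = (\<lambda>x. complex_of_real (h x) / \<eta>)"
    and "M_eigenfunction a h0 1 e0"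
    and "j \<in> {0, 1}"
  shows "\<forall>\<alpha> \<beta>. bvp_spectrum j a (q_fam a h0 e0 \<alpha>) = bvp_spectrum j a (q_fam a h0 e0 \<beta>)"
proof -
  have "L2_on {5*a/2<..<3*a} h0"
    using assms(3) unfolding L2_on_def assms(7) by (auto simp: norm_divide power_divide)
  from char_fun_q_fam[OF assms(1,2) this assms(8,9)]
  \<comment> \<open>Equality as functions of the spectral parameter, so that the zeros and also
    their orders \<open>zorder\<close> coincide.\<close>
  have eq: "char_fun j a (q_fam a h0 e0 \<alpha>) = char_fun j a (q_fam a h0 e0 \<beta>)" for \<alpha> \<beta>
    by (rule ext)
  have "bvp_spectrum j a (q_fam a h0 e0 \<alpha>) = bvp_spectrum j a (q_fam a h0 e0 \<beta>)" for \<alpha> \<beta>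
    unfolding bvp_spectrum_def eq[of \<alpha> \<beta>] by (rule refl)
  then show ?thesis by blast
qed

end
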